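(* Let $1<p<\infty$ and $X=L_p$. Assume that every set $G_n$ is convex, and that the Jackson-type inequality (J), the Bernstein-type inequality (B) and the realization inequality (R) stated in the context hold for $X=L_p$ with some $\alpha>0$. Put $\tau=\max(2,p)$ and $\theta=\min(2,p)$. Then there are constants $C,C'>0$ such that for all $f\in L_p$ and $n\in\mathbb N$ $$\Big(\sum_{k=n+1}^\infty 2^{-k\alpha\tau}\|P_{2^k}(f)\|_Y^\tau\Big)^{1/\tau}\le C\,K(f,2^{-n\alpha};L_p,Y)$$ and $$K(f,2^{-n\alpha};L_p,Y)\le C'\Big(\sum_{k=n+1}^\infty 2^{-k\alpha\theta}\|P_{2^k}(f)\|_Y^\theta\Big)^{1/\theta}.$$
   Context: $X=L_p$ is a Lebesgue space with its usual norm $\|\cdot\|_X$, and $Y\subset X$ is a function space with (semi-)norm $\|\cdot\|_Y$. The $K$-functional is $K(f,t;X,Y)=\inf\{\|f-g\|_X+t\|g\|_Y: g\in Y\}$ for $f\in X$, $t>0$. $\{G_n\}_{n\ge1}$ is a family of subsets of $Y$ such that $0\in G_1$, $G_n\subset G_{n+1}$, $G_n=-G_n$, and the closure of $\bigcup_n G_n$ in $X$ is $X$. Put $E_n(f)_X=\inf\{\|f-g\|_X: g\in G_n\}$. $P_n(f)\in G_n$ denotes an element of best approximation to $f\in X$ from $G_n$ (assumed to exist), i.e. $\|f-P_n(f)\|_X=E_n(f)_X$. (J) There is $c_1>0$ with $E_n(f)_X\le c_1n^{-\alpha}\|f\|_Y$ for all $f\in Y$, $n\in\mathbb N$. (B)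 There is $c_2>0$ with $\|g_1-g_2\|_Y\le c_2n^{\alpha}\|g_1-g_2\|_X$ for all $g_1,g_2\in G_n$, $n\in\mathbb N$. (R) There is $c_3>0$ such that for all $f\in X$, $n\in\mathbb N$: $\inf\{\|f-g\|_X+n^{-\alpha}\|g\|_Y: g\in G_n\}\le c_3K(f,n^{-\alpha};X,Y)$. *)

theory Defs
  imports "HOL-Analysis.Analysis" "HOL-Library.Function_Algebras"
begin

text \<open>
  The value type has sort \<open>{real_normed_field, euclidean_space}\<close>, which covers both
  \<^typ>\<open>real\<close> and \<^typ>\<open>complex\<close> as scalar field.  The underlying measure space is arbitrary.

  Elements of the Lebesgue space are represented by measurable functions instead of equivalence
  classes; subsets of the space of classes correspond to sets of functions that are closed under
  almost-everywhere equality (\<open>ae_closed\<close>), and a seminorm on classes corresponds to a seminorm on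
  functions that does not distinguish functions equal almost everywhere (\<open>ae_invariant_on\<close>).
\<close>

definition Lp :: "'a measure \<Rightarrow> real \<Rightarrow> ('a \<Rightarrow> 'k::{real_normed_field, euclidean_space}) set" where
  "Lp M p = {f \<in> borel_measurable M. integrable M (\<lambda>x. norm (f x) powr p)}"

definition Lp_norm :: "'a measure \<Rightarrow> real \<Rightarrow> ('a \<Rightarrow> 'k::{real_normed_field, euclidean_space}) \<Rightarrow> real" where
  "Lp_norm M p f = (LINT x|M. norm (f x) powr p) powr (1 / p)"

definition ae_closed :: "'a measure \<Rightarrow> ('a \<Rightarrow> 'k::{real_normed_field, euclidean_space}) set \<Rightarrow> bool" where
  "ae_closed M S \<longleftrightarrow>
     (\<forall>f\<in>S. \<forall>g\<in>borel_measurable M. (AE x in M. f x = g x) \<longrightarrow> g \<in> S)"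

definition ae_invariant_on ::
  "'a measure \<Rightarrow> ('a \<Rightarrow> 'k::{real_normed_field, euclidean_space}) set \<Rightarrow> (('a \<Rightarrow> 'k) \<Rightarrow> real) \<Rightarrow> bool" where
  "ae_invariant_on M Y N \<longleftrightarrow>
     (\<forall>f\<in>Y. \<forall>g\<in>Y. (AE x in M. f x = g x) \<longrightarrow> N f = N g)"

definition linear_subspace :: "('a \<Rightarrow> 'k::{real_normed_field, euclidean_space}) set \<Rightarrow> bool" where
  "linear_subspace Y \<longleftrightarrow>
     0 \<in> Y \<and> (\<forall>f\<in>Y. \<forall>g\<in>Y. f + g \<in> Y) \<and> (\<forall>c. \<forall>f\<in>Y. (\<lambda>x. c * f x) \<in> Y)"

definition seminorm_on ::
  "('a \<Rightarrow> 'k::{real_normed_field, euclidean_space}) set \<Rightarrow> (('a \<Rightarrow> 'k) \<Rightarrow> real) \<Rightarrow> bool" where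
  "seminorm_on Y N \<longleftrightarrow>
     (\<forall>f\<in>Y. 0 \<le> N f) \<and>
     (\<forall>c. \<forall>f\<in>Y. N (\<lambda>x. c * f x) = norm c * N f) \<and>
     (\<forall>f\<in>Y. \<forall>g\<in>Y. N (f + g) \<le> N f + N g)"

text \<open>
  The function type is not an instance of \<^class>\<open>real_vector\<close>, so the library's \<^const>\<open>convex\<close>
  does not apply to sets of functions.
\<close>

definition convex_fun_set :: "('a \<Rightarrow> 'k::{real_normed_field, euclidean_space}) set \<Rightarrow> bool" where
  "convex_fun_set S \<longleftrightarrow>
     (\<forall>f\<in>S. \<forall>g\<in>S. \<forall>u\<ge>0. \<forall>v\<ge>0. u + v = 1 \<longrightarrow> (\<lambda>x. u *\<^sub>R f x + v *\<^sub>R g x) \<in> S)"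

definition K_functional ::
  "'a measure \<Rightarrow> real \<Rightarrow> ('a \<Rightarrow> 'k::{real_normed_field, euclidean_space}) set \<Rightarrow>
   (('a \<Rightarrow> 'k) \<Rightarrow> real) \<Rightarrow> ('a \<Rightarrow> 'k) \<Rightarrow> real \<Rightarrow> real" where
  "K_functional M p Y N f t = (INF g\<in>Y. Lp_norm M p (f - g) + t * N g)"

definition approx_error ::
  "'a measure \<Rightarrow> real \<Rightarrow> ('a \<Rightarrow> 'k::{real_normed_field, euclidean_space}) set \<Rightarrow> ('a \<Rightarrow> 'k) \<Rightarrow> real" where
  "approx_error M p S f = (INF g\<in>S. Lp_norm M p (f - g))"

end

theory Submission
  imports Defs
begin

text \<open>
  Write \<open>E k\<close> for the error of best approximation of \<open>f\<close> from \<open>G (2 ^ k)\<close> and \<open>\<eta> k\<close> for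
  \<open>2 powr (- k \<alpha>) * normY (P (2 ^ k) f)\<close>.

  First inequality: since the midpoint of two elements of a convex set stays in the set, uniform convexity
  of \<open>L\<^sub>p\<close> bounds \<open>\<parallel>P (2 ^ (k + 1)) f - P (2 ^ k) f\<parallel> powr \<tau>\<close> by a multiple of
  \<open>E k powr \<tau> - E (k + 1) powr \<tau>\<close>, which telescopes. By the Bernstein inequality \<open>\<eta> (k + 1)\<close> is at most
  \<open>2 powr (- \<alpha>) * \<eta> k\<close> plus a multiple of the norm of such an increment, and by realization \<open>\<eta> n\<close> and \<open>E n\<close> are
  bounded by the K-functional.

  Second inequality: it suffices to bound \<open>E n powr \<theta>\<close> by the sum of the \<open>\<eta> k powr \<theta>\<close>. Put \<open>m = k + 1\<close>
  and \<open>y = f - P (2 ^ m) f\<close>. Jackson's inequality decomposes \<open>P (2 ^ m) f\<close> into an element of \<open>G (2 ^ k)\<close>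
  and pieces \<open>b\<^sub>i\<close> of norm at most a multiple of \<open>2 powr (- i \<alpha>) * \<eta> m\<close>, where \<open>b\<^sub>i\<close> is a direction in
  which \<open>G (2 ^ (m + i))\<close> is essentially unbounded, so that \<open>\<parallel>y - t b\<^sub>i\<parallel> \<ge> E (m + i)\<close> for all \<open>t\<close>. For
  linear \<open>G\<close> no look-ahead would be needed; for convex \<open>G\<close> the element \<open>P (2 ^ m) f\<close> itself need not be such a
  direction at level \<open>m\<close>. Uniform smoothness of \<open>L\<^sub>p\<close> and convexity of the norm give
  \<open>E k powr \<theta> \<le> E m powr \<theta> + (\<Sum>i. w\<^sub>i * (E m powr \<theta> - E (m + i) powr \<theta>)) + const * \<eta> m powr \<theta>\<close> with
  freely chosen geometrically decaying weights \<open>w\<^sub>i\<close>; for small weights the middle sum is absorbed after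
  summation over \<open>k\<close>.
\<close>

section \<open>Pointwise inequalities\<close>

lemma convex_on_powr_nonneg:
  fixes p :: real
  assumes "1 \<le> p"
  shows "convex_on {0..} (\<lambda>x. x powr p)"
proof (rule convex_onI)
  fix t x y :: real
  assume t: "0 < t" "t < 1" and xy: "x \<in> {0..}" "y \<in> {0..}"
  \<comment> \<open>Handles a zero endpoint, where convexity on the open half-line does not apply: a
    factor \<open>s\<close> below 1 only shrinks when raised to a power
    \<open>p \<ge> 1\<close>.\<close>
  have scale: "(s * z) powr p \<le> s * z powr p" if "0 < s" "s < 1" "0 \<le> z" for s z :: real
  proof -
    have "s powr p \<le> s powr 1"
      using that assms by (intro powr_mono') auto
    then show ?thesis
      using that by (simp add: powr_mult mult_right_mono)
  qed
  show "((1 - t) *\<^sub>R x + t *\<^sub>R y) powr p \<le> (1 - t) * x powr p + t * y powr p"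
  proof (cases "x = 0 \<or> y = 0")
    case True
    then show ?thesis
      using scale[of t y] scale[of "1 - t" x] t xy by auto
  next
    case False
    then show ?thesis
      using convex_onD[OF powr_convex[OF assms], of t x y] t xy by auto
  qed
qed (rule convex_real_interval)

lemma powr_mean_le:
  fixes a b q :: real
  assumes "1 \<le> q" "0 \<le> a" "0 \<le> b"
  shows "((a + b) / 2) powr q \<le> (a powr q + b powr q) / 2"
  using convex_onD[OF convex_on_powr_nonneg[OF assms(1)], of "1/2" a b] assms
  by (simp add: field_simps)

lemma powr_add_le_two_powr:
  fixes a b q :: real
  assumes "1 \<le> q" "0 \<le> a" "0 \<le> b"
  shows "(a + b) powr q \<le> 2 powr (q - 1) * (a powr q + b powr q)"
proof -
  have "(a + b) powr q = 2 powr q * ((a + b) / 2) powr q"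
  proof -
    have "a + b = 2 * ((a + b) / 2)"
      by argo
    then show ?thesis
      using powr_mult[of 2 "(a + b) / 2" q] assms by argo
  qed
  also have "\<dots> \<le> 2 powr q * ((a powr q + b powr q) / 2)"
    using powr_mean_le[OF assms] by (intro mult_left_mono) auto
  also have "\<dots> = 2 powr (q - 1) * (a powr q + b powr q)"
    by (simp add: powr_diff)
  finally show ?thesis .
qed

lemma powr_mult_self:
  fixes a q :: real
  assumes "0 \<le> a"
  shows "a powr q = a * a powr (q - 1)"
  using powr_mult_base[OF assms, of "q - 1"] by simp

lemma powr_add_ge:
  fixes a b q :: real
  assumes "1 \<le> q" "0 \<le> a" "0 \<le> b"
  shows "a powr q + b powr q \<le> (a + b) powr q"
proof -
  have "a powr q + b powr q = a * a powr (q - 1) + b * b powr (q - 1)"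
    using assms by (simp only: powr_mult_self[of a q] powr_mult_self[of b q])
  also have "\<dots> \<le> a * (a + b) powr (q - 1) + b * (a + b) powr (q - 1)"
    using assms by (intro add_mono mult_left_mono powr_mono2) auto
  also have "\<dots> = (a + b) powr q"
    using assms by (simp add: powr_mult_self[of "a + b" q] distrib_right)
  finally show ?thesis .
qed

text \<open>Substituting \<open>q\<close>-th powers turns the claim into superadditivity for the
  exponent \<open>1 / q\<close>.\<close>

lemma powr_add_le:
  fixes a b q :: real
  assumes "0 < q" "q \<le> 1" "0 \<le> a" "0 \<le> b"
  shows "(a + b) powr q \<le> a powr q + b powr q"
proof -
  have "(a + b) powr q = ((a powr q) powr (1 / q) + (b powr q) powr (1 / q)) powr q"
    using assms by (simp add: powr_powr)
  also have "\<dots> \<le> ((a powr q + b powr q) powr (1 / q)) powr q"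
    using assms by (intro powr_mono2 powr_add_ge) auto
  also have "\<dots> = a powr q + b powr q"
    using assms by (simp add: powr_powr)
  finally show ?thesis .
qed

text \<open>Concavity comes from convexity for the exponent \<open>1 / q\<close>, by the same
  substitution.\<close>

lemma powr_mean_ge:
  fixes a b q :: real
  assumes "0 < q" "q \<le> 1" "0 \<le> a" "0 \<le> b"
  shows "(a powr q + b powr q) / 2 \<le> ((a + b) / 2) powr q"
proof -
  have "(a powr q + b powr q) / 2 = (((a powr q + b powr q) / 2) powr (1 / q)) powr q"
    using assms by (simp add: powr_powr)
  also have "\<dots> \<le> (((a powr q) powr (1 / q) + (b powr q) powr (1 / q)) / 2) powr q"
    using assms by (intro powr_mono2 powr_mean_le) auto
  also have "\<dots> = ((a + b) / 2) powr q"
    using assms by (simp add: powr_powr)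
  finally show ?thesis .
qed

lemma powr_Young:
  fixes a b \<kappa> :: real
  assumes "0 < \<kappa>" "\<kappa> < 1" "0 \<le> a" "0 \<le> b"
  shows "a powr \<kappa> * b powr (1 - \<kappa>) \<le> \<kappa> * a + (1 - \<kappa>) * b"
proof (cases "a = 0 \<or> b = 0")
  case True
  then show ?thesis
    using assms by auto
next
  case False
  then show ?thesis
    using assms Youngs_inequality_0[of \<kappa> "1 - \<kappa>" a b] by simp
qed

text \<open>For \<open>1 < q < 2\<close> the second derivative of the power is unbounded near
  \<open>h = -1\<close>, so a bound on it cannot be used. Instead an induction lowers
  \<open>q\<close> by one: Bernoulli's inequality, with \<open>C = 0\<close>, covers exponents up to
  1, and each step restores a factor \<open>1 + h\<close>, which is at most 2.\<close>

lemma one_plus_powr_quadratic_bound: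
  fixes q :: real
  assumes "0 \<le> q"
  obtains C where "0 \<le> C" "\<And>h. -1 \<le> h \<Longrightarrow> h \<le> 1 \<Longrightarrow> (1 + h) powr q \<le> 1 + q * h + C * h\<^sup>2"
proof -
  have "\<exists>C\<ge>0. \<forall>h. -1 \<le> h \<longrightarrow> h \<le> 1 \<longrightarrow> (1 + h) powr q \<le> 1 + q * h + C * h\<^sup>2"
    if "0 \<le> q" "q \<le> real n + 1" for n :: nat and q :: real
    using that
  proof (induction n arbitrary: q)
    case 0
    have "(1 + h) powr q \<le> 1 + q * h + 0 * h\<^sup>2" if "-1 \<le> h" for h
    proof (cases "q = 0 \<or> q = 1")
      case True
      then show ?thesis using that by auto
    next
      case False
      then show ?thesis
        using powr_Young[of q "1 + h" 1] that 0 by (simp add: algebra_simps)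
    qed
    then show ?case
      by (metis order_refl)
  next
    case (Suc n)
    show ?case
    proof (cases "q \<le> 1")
      case True
      then show ?thesis
        using Suc by (intro Suc.IH) auto
    next
      case False
      obtain C where C: "0 \<le> C"
        "\<And>h. -1 \<le> h \<Longrightarrow> h \<le> 1 \<Longrightarrow> (1 + h) powr (q - 1) \<le> 1 + (q - 1) * h + C * h\<^sup>2"
        using Suc.IH[of "q - 1"] Suc.prems False by auto
      have "(1 + h) powr q \<le> 1 + q * h + (q + 2 * C) * h\<^sup>2" if h: "-1 \<le> h" "h \<le> 1" for h
      proof -
        have "(1 + h) powr q = (1 + h) * (1 + h) powr (q - 1)"
          using h by (intro powr_mult_self) auto
        also have "\<dots> \<le> (1 + h) * (1 + (q - 1) * h + C * h\<^sup>2)"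
          using h C(2) by (intro mult_left_mono) auto
        also have "\<dots> = 1 + q * h + (q - 1) * h\<^sup>2 + (C * h\<^sup>2) * (1 + h)"
          by (simp add: power2_eq_square algebra_simps)
        also have "\<dots> \<le> 1 + q * h + q * h\<^sup>2 + (C * h\<^sup>2) * 2"
          using h C(1) False by (intro add_mono mult_left_mono mult_right_mono) auto
        finally show ?thesis
          by (simp add: algebra_simps)
      qed
      then show ?thesis
        using C(1) False by (intro exI[of _ "q + 2 * C"]) auto
    qed
  qed
  from this[OF assms, of "nat \<lceil>q\<rceil>"] show ?thesis
    using that assms by (metis add_increasing2 of_nat_ceiling zero_le_one)
qed

text \<open>Adding the quadratic bounds at \<open>h / m\<close> and \<open>- h / m\<close> cancels
  the linear terms; homogeneity then restores \<open>m\<close>.\<close>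

lemma powr_plus_powr_minus_le:
  fixes q :: real
  assumes "1 \<le> q"
  obtains C where "0 \<le> C"
    "\<And>m h. \<bar>h\<bar> \<le> m \<Longrightarrow> (m + h) powr q + (m - h) powr q \<le> 2 * m powr q + C * m powr (q - 2) * h\<^sup>2"
proof -
  obtain C where C: "0 \<le> C" "\<And>h. -1 \<le> h \<Longrightarrow> h \<le> 1 \<Longrightarrow> (1 + h) powr q \<le> 1 + q * h + C * h\<^sup>2"
    using one_plus_powr_quadratic_bound[of q] assms by auto
  have "(m + h) powr q + (m - h) powr q \<le> 2 * m powr q + 2 * C * m powr (q - 2) * h\<^sup>2"
    if "\<bar>h\<bar> \<le> m" for m h
  proof (cases "m = 0")
    case True
    then show ?thesis using that by simp
  next
    case False
    then have m: "0 < m" using that by auto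
    have eq: "m + h = m * (1 + h / m)" "m - h = m * (1 + (- h / m))"
      using m by (auto simp: field_simps)
    have b: "-1 \<le> h / m" "h / m \<le> 1"
      using that m by (auto simp: field_simps abs_le_iff)
    have "(m + h) powr q + (m - h) powr q = m powr q * ((1 + h / m) powr q + (1 + (- h / m)) powr q)"
      unfolding eq using b m by (subst (1 2) powr_mult) (auto simp: algebra_simps)
    also have "\<dots> \<le> m powr q * ((1 + q * (h / m) + C * (h / m)\<^sup>2) + (1 + q * (- h / m) + C * (- h / m)\<^sup>2))"
      using b C(2)[of "h / m"] C(2)[of "- h / m"] by (intro mult_left_mono add_mono) auto
    also have "\<dots> = 2 * m powr q + 2 * C * (m powr q / m\<^sup>2) * h\<^sup>2"
      using m by (simp add: field_simps power2_eq_square)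
    also have "m powr q / m\<^sup>2 = m powr (q - 2)"
      using m by (simp add: powr_diff)
    finally show ?thesis .
  qed
  then show ?thesis
    using that[of "2 * C"] C(1) by auto
qed

section \<open>Convexity and smoothness inequalities for vectors of an inner product space\<close>

lemma norm_powr_eq_power2_powr:
  fixes x :: "'v::real_inner"
  shows "norm x powr p = (norm x ^ 2) powr (p / 2)"
proof (cases "x = 0")
  case False
  then have "norm x ^ 2 = norm x powr 2"
    by (simp add: powr_numeral)
  then have "(norm x ^ 2) powr (p / 2) = norm x powr (2 * (p / 2))"
    by (simp only: powr_powr)
  then show ?thesis
    by simp
qed simp

lemma parallelogram_norm_squared:
  fixes x z :: "'v::real_inner"
  shows "(norm (x + z))\<^sup>2 + (norm (x - z))\<^sup>2 = 2 * (norm x)\<^sup>2 + 2 * (norm z)\<^sup>2"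
  by (simp add: power2_norm_eq_inner inner_add_left inner_add_right inner_diff_left inner_diff_right inner_commute)

text \<open>The parallelogram law is the case \<open>p = 2\<close>. For
  \<open>p / 2 \<ge> 1\<close>, superadditivity of the power handles the left side and convexity the
  right side.\<close>

lemma Clarkson_pointwise_ge:
  fixes x z :: "'v::real_inner"
  assumes "2 \<le> p"
  shows "2 * norm x powr p + 2 * norm z powr p \<le> norm (x + z) powr p + norm (x - z) powr p"
proof -
  have "2 * norm x powr p + 2 * norm z powr p
      \<le> 2 * ((norm x)\<^sup>2 + (norm z)\<^sup>2) powr (p / 2)"
    using powr_add_ge[of "p / 2" "(norm x)\<^sup>2" "(norm z)\<^sup>2"] assms
    by (simp add: norm_powr_eq_power2_powr[of _ p])
  also have "(norm x)\<^sup>2 + (norm z)\<^sup>2 = ((norm (x + z))\<^sup>2 + (norm (x - z))\<^sup>2) / 2"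
    by (simp add: parallelogram_norm_squared)
  also have "2 * (((norm (x + z))\<^sup>2 + (norm (x - z))\<^sup>2) / 2) powr (p / 2)
      \<le> norm (x + z) powr p + norm (x - z) powr p"
    using powr_mean_le[of "p / 2" "(norm (x + z))\<^sup>2" "(norm (x - z))\<^sup>2"] assms
    by (simp add: norm_powr_eq_power2_powr[of _ p])
  finally show ?thesis .
qed

text \<open>For \<open>p / 2 \<le> 1\<close> both power inequalities used with the parallelogram law
  reverse.\<close>

lemma Clarkson_pointwise_le:
  fixes x z :: "'v::real_inner"
  assumes "0 < p" "p \<le> 2"
  shows "norm (x + z) powr p + norm (x - z) powr p \<le> 2 * norm x powr p + 2 * norm z powr p"
proof -
  have "norm (x + z) powr p + norm (x - z) powr p
      \<le> 2 * (((norm (x + z))\<^sup>2 + (norm (x - z))\<^sup>2) / 2) powr (p / 2)"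
    using powr_mean_ge[of "p / 2" "(norm (x + z))\<^sup>2" "(norm (x - z))\<^sup>2"] assms
    by (simp add: norm_powr_eq_power2_powr[of _ p])
  also have "((norm (x + z))\<^sup>2 + (norm (x - z))\<^sup>2) / 2 = (norm x)\<^sup>2 + (norm z)\<^sup>2"
    by (simp add: parallelogram_norm_squared)
  also have "2 * ((norm x)\<^sup>2 + (norm z)\<^sup>2) powr (p / 2) \<le> 2 * norm x powr p + 2 * norm z powr p"
    using powr_add_le[of "p / 2" "(norm x)\<^sup>2" "(norm z)\<^sup>2"] assms
    by (simp add: norm_powr_eq_power2_powr[of _ p])
  finally show ?thesis .
qed

text \<open>The squared norms of \<open>x + z\<close> and \<open>x - z\<close> have the form
  \<open>m + h\<close> and \<open>m - h\<close>, so the symmetric expansion of the power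
  \<open>p / 2\<close> applies. The remainder is kept as a product because Hoelder's inequality is
  applied to it after integration.\<close>

lemma smoothness_pointwise:
  fixes p :: real
  assumes "2 \<le> p"
  obtains C where "0 \<le> C"
    "\<And>x z :: 'v::real_inner. norm (x + z) powr p + norm (x - z) powr p
       \<le> 2 * norm x powr p + C * (((norm x)\<^sup>2 + (norm z)\<^sup>2) powr (p / 2 - 1) * (norm z)\<^sup>2)"
proof -
  define q where "q = p / 2"
  have q: "1 \<le> q" using assms by (simp add: q_def)
  obtain C where C: "0 \<le> C"
    "\<And>m h. \<bar>h\<bar> \<le> m \<Longrightarrow> (m + h) powr q + (m - h) powr q \<le> 2 * m powr q + C * m powr (q - 2) * h\<^sup>2"
    using powr_plus_powr_minus_le[OF q] by blast
  have "norm (x + z) powr p + norm (x - z) powr p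
       \<le> 2 * norm x powr p + (4 * C + 2 * q) * (((norm x)\<^sup>2 + (norm z)\<^sup>2) powr (q - 1) * (norm z)\<^sup>2)"
    for x z :: 'v
  proof (cases "x = 0 \<and> z = 0")
    case True
    then show ?thesis by simp
  next
    case False
    define m h where "m = (norm x)\<^sup>2 + (norm z)\<^sup>2" and "h = 2 * (x \<bullet> z)"
    have m: "0 < m"
      using False by (auto simp: m_def add_pos_nonneg add_nonneg_pos)
    have eq: "(norm (x + z))\<^sup>2 = m + h" "(norm (x - z))\<^sup>2 = m - h"
      by (simp_all add: m_def h_def power2_norm_eq_inner inner_add_left inner_add_right
          inner_diff_left inner_diff_right inner_commute)
    have hm: "\<bar>h\<bar> \<le> m"
      using zero_le_power2[of "norm (x + z)"] zero_le_power2[of "norm (x - z)"]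
      unfolding eq by (simp add: abs_le_iff)
    \<comment> \<open>Cauchy-Schwarz trades one factor of \<open>h\<close> squared for
      \<open>m\<close>, which raises the exponent \<open>q - 2\<close> to
      \<open>q - 1\<close>.\<close>
    have "(x \<bullet> z)\<^sup>2 \<le> (norm x)\<^sup>2 * (norm z)\<^sup>2"
      using Cauchy_Schwarz_ineq[of x z] by (simp add: power2_norm_eq_inner)
    then have "h\<^sup>2 \<le> 4 * ((norm x)\<^sup>2 * (norm z)\<^sup>2)"
      by (simp add: h_def power_mult_distrib)
    also have "\<dots> \<le> 4 * (m * (norm z)\<^sup>2)"
      by (intro mult_left_mono mult_right_mono) (auto simp: m_def)
    finally have h2: "h\<^sup>2 \<le> 4 * (m * (norm z)\<^sup>2)" .
    have mq: "m powr (q - 2) * m = m powr (q - 1)"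
      using m by (simp add: powr_diff power2_eq_square)
    have "C * m powr (q - 2) * h\<^sup>2 \<le> C * m powr (q - 2) * (4 * (m * (norm z)\<^sup>2))"
      using C(1) h2 by (intro mult_left_mono) auto
    also have "\<dots> = 4 * C * (m powr (q - 2) * m * (norm z)\<^sup>2)"
      by simp
    finally have t1: "C * m powr (q - 2) * h\<^sup>2 \<le> 4 * C * (m powr (q - 1) * (norm z)\<^sup>2)"
      unfolding mq .
    \<comment> \<open>Tangent-line inequality for the convex power at \<open>m\<close>, obtained
      from Young's inequality with weights \<open>1 / q\<close> and
      \<open>1 - 1 / q\<close>.\<close>
    have t2: "m powr q \<le> ((norm x)\<^sup>2) powr q + q * (m powr (q - 1) * (norm z)\<^sup>2)"
    proof (cases "q = 1")
      case True
      then show ?thesis using m by (simp add: m_def)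
    next
      case False
      have "((norm x)\<^sup>2 powr q) powr (1/q) * (m powr q) powr (1 - 1/q)
          \<le> 1/q * (norm x)\<^sup>2 powr q + (1 - 1/q) * m powr q"
        using False q by (intro powr_Young) auto
      moreover have "((norm x)\<^sup>2 powr q) powr (1/q) = (norm x)\<^sup>2"
        using q by (simp add: powr_powr)
      moreover have "(m powr q) powr (1 - 1/q) = m powr (q - 1)"
        using q by (simp add: powr_powr right_diff_distrib)
      ultimately have "(norm x)\<^sup>2 * m powr (q - 1) \<le> 1/q * (norm x)\<^sup>2 powr q + (1 - 1/q) * m powr q"
        by simp
      then have "q * ((norm x)\<^sup>2 * m powr (q - 1)) \<le> (norm x)\<^sup>2 powr q + (q - 1) * m powr q"
        using q by (simp add: field_simps)
      moreover have "m powr q = (norm x)\<^sup>2 * m powr (q - 1) + (norm z)\<^sup>2 * m powr (q - 1)"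
        using m powr_mult_self[of m q] by (simp add: m_def distrib_right)
      ultimately show ?thesis
        by (simp add: algebra_simps)
    qed
    have "norm (x + z) powr p + norm (x - z) powr p = (m + h) powr q + (m - h) powr q"
      by (simp only: norm_powr_eq_power2_powr[of _ p] eq q_def)
    also have "\<dots> \<le> 2 * m powr q + C * m powr (q - 2) * h\<^sup>2"
      by (rule C(2)[OF hm])
    also have "\<dots> \<le> 2 * (((norm x)\<^sup>2) powr q + q * (m powr (q - 1) * (norm z)\<^sup>2))
        + 4 * C * (m powr (q - 1) * (norm z)\<^sup>2)"
      by (intro add_mono mult_left_mono t1 t2) simp
    also have "\<dots> = 2 * norm x powr p + (4 * C + 2 * q) * (m powr (q - 1) * (norm z)\<^sup>2)"
      by (simp add: norm_powr_eq_power2_powr[of _ p] q_def algebra_simps)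
    finally show ?thesis
      unfolding m_def .
  qed
  then show ?thesis
    using that[of "4 * C + 2 * q"] C(1) q unfolding q_def by auto
qed

text \<open>The summand \<open>e\<close> keeps the base positive, so the power is twice
  differentiable along the line \<open>x + t z\<close>. Its second derivative on
  \<open>[-1, 1]\<close> is at least \<open>m\<close>; hence subtracting
  \<open>m / 2 * t\<^sup>2\<close> leaves a convex function, which is compared at \<open>-1\<close>,
  \<open>0\<close> and \<open>1\<close>.\<close>

lemma convexity_pointwise_regularized:
  fixes x z :: "'v::real_inner"
  assumes p: "1 < p" "p \<le> 2" and e: "0 < e"
  shows "2 * ((norm x)\<^sup>2 + e) powr (p / 2) + p * (p - 1) * ((norm x + norm z)\<^sup>2 + e) powr (p / 2 - 1) * (norm z)\<^sup>2
    \<le> ((norm (x + z))\<^sup>2 + e) powr (p / 2) + ((norm (x - z))\<^sup>2 + e) powr (p / 2)"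
proof -
  define q where "q = p / 2"
  define n where "n = (\<lambda>t::real. (norm x)\<^sup>2 + 2 * t * (x \<bullet> z) + t\<^sup>2 * (norm z)\<^sup>2 + e)"
  define n' where "n' = (\<lambda>t::real. 2 * (x \<bullet> z) + 2 * t * (norm z)\<^sup>2)"
  define m where "m = p * (p - 1) * ((norm x + norm z)\<^sup>2 + e) powr (q - 1) * (norm z)\<^sup>2"
  define f where "f = (\<lambda>t. n t powr q - m / 2 * t\<^sup>2)"
  have n_eq: "n t = (norm (x + t *\<^sub>R z))\<^sup>2 + e" for t
    unfolding n_def power2_norm_eq_inner
    by (simp add: inner_add_left inner_add_right inner_commute[of z x] power2_eq_square algebra_simps)
  have n_pos: "0 < n t" for t
    unfolding n_eq using e by (intro add_nonneg_pos) auto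
  have dn: "(n has_real_derivative n' t) (at t)" for t
    unfolding n_def n'_def by (auto intro!: derivative_eq_intros)
  have dn': "(n' has_real_derivative 2 * (norm z)\<^sup>2) (at t)" for t
    unfolding n'_def by (auto intro!: derivative_eq_intros)
  have dpow: "((\<lambda>t. n t powr r) has_real_derivative r * n t powr (r - 1) * n' t) (at t)" for r t
    using DERIV_fun_powr[OF dn[of t] n_pos[of t], of r] by simp
  have "convex_on {-1..1} f"
  proof (rule f''_ge0_imp_convex)
    fix t :: real
    show "(f has_real_derivative q * n t powr (q - 1) * n' t - m * t) (at t)"
    proof -
      have "((\<lambda>t. m / 2 * t\<^sup>2) has_real_derivative m * t) (at t)"
        by (auto intro!: derivative_eq_intros)
      then show ?thesis
        unfolding f_def by (intro DERIV_diff dpow)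
    qed
    show "((\<lambda>t. q * n t powr (q - 1) * n' t - m * t) has_real_derivative
        q * ((q - 1) * n t powr (q - 2) * n' t * n' t + n t powr (q - 1) * (2 * (norm z)\<^sup>2)) - m) (at t)"
    proof -
      have "((\<lambda>t. q * (n t powr (q - 1) * n' t) - m * t) has_real_derivative
          q * ((q - 1) * n t powr (q - 1 - 1) * n' t * n' t + 2 * (norm z)\<^sup>2 * n t powr (q - 1)) - m) (at t)"
        by (intro DERIV_diff DERIV_cmult DERIV_mult dpow dn' DERIV_cmult_Id)
      then show ?thesis
        by (simp add: mult.assoc mult.commute[of _ "n t powr (q - 1)"])
    qed
    assume t: "t \<in> {-1..1}"
    \<comment> \<open>Cauchy-Schwarz bounds the negative part of the second derivative by a fraction
      \<open>2 - 2 * q\<close> of the positive part; what remains carries the factor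
      \<open>2 * q * (2 * q - 1) = p * (p - 1)\<close>.\<close>
    have cs: "(n' t)\<^sup>2 \<le> 4 * n t * (norm z)\<^sup>2"
    proof -
      have "n' t = 2 * ((x + t *\<^sub>R z) \<bullet> z)"
        by (simp add: n'_def inner_add_left power2_norm_eq_inner)
      then have "(n' t)\<^sup>2 \<le> 4 * ((norm (x + t *\<^sub>R z))\<^sup>2 * (norm z)\<^sup>2)"
        using Cauchy_Schwarz_ineq[of "x + t *\<^sub>R z" z] by (simp add: power_mult_distrib power2_norm_eq_inner)
      also have "\<dots> \<le> 4 * (n t * (norm z)\<^sup>2)"
        unfolding n_eq using e by (intro mult_left_mono mult_right_mono) auto
      finally show ?thesis by simp
    qed
    have "(1 - q) * n t powr (q - 2) * (n' t)\<^sup>2 \<le> (1 - q) * n t powr (q - 2) * (4 * n t * (norm z)\<^sup>2)"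
      using p cs by (intro mult_left_mono) (auto simp: q_def)
    also have "\<dots> = (4 - 4 * q) * (n t powr (q - 1) * (norm z)\<^sup>2)"
      using n_pos[of t] by (simp add: powr_diff power2_eq_square field_simps)
    finally have a: "(1 - q) * n t powr (q - 2) * (n' t)\<^sup>2 \<le> (4 - 4 * q) * (n t powr (q - 1) * (norm z)\<^sup>2)" .
    have nb: "n t \<le> (norm x + norm z)\<^sup>2 + e"
    proof -
      have "norm (x + t *\<^sub>R z) \<le> norm x + \<bar>t\<bar> * norm z"
        using norm_triangle_ineq[of x "t *\<^sub>R z"] by simp
      also have "\<dots> \<le> norm x + 1 * norm z"
        using t by (intro add_left_mono mult_right_mono) auto
      finally show ?thesis
        unfolding n_eq by (simp add: power_mono)
    qed
    \<comment> \<open>The exponent \<open>q - 1\<close> is not positive, so the upper bound on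
      \<open>n t\<close> becomes a lower bound on its power.\<close>
    have "((norm x + norm z)\<^sup>2 + e) powr (q - 1) \<le> n t powr (q - 1)"
      using p nb n_pos[of t] by (intro powr_mono2') (auto simp: q_def)
    then have b: "((norm x + norm z)\<^sup>2 + e) powr (q - 1) * (norm z)\<^sup>2 \<le> n t powr (q - 1) * (norm z)\<^sup>2"
      by (intro mult_right_mono) auto
    have "m \<le> 2 * q * (2 * q - 1) * (n t powr (q - 1) * (norm z)\<^sup>2)"
      using mult_left_mono[OF b, of "p * (p - 1)"] p by (simp add: m_def q_def mult.assoc)
    also have "\<dots> = q * (2 * (n t powr (q - 1) * (norm z)\<^sup>2) - (4 - 4 * q) * (n t powr (q - 1) * (norm z)\<^sup>2))"
      by (simp add: algebra_simps)
    also have "\<dots> \<le> q * (2 * (n t powr (q - 1) * (norm z)\<^sup>2) - (1 - q) * n t powr (q - 2) * (n' t)\<^sup>2)"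
      using p a by (intro mult_left_mono) (auto simp: q_def)
    also have "\<dots> = q * ((q - 1) * n t powr (q - 2) * n' t * n' t + n t powr (q - 1) * (2 * (norm z)\<^sup>2))"
      by (simp add: power2_eq_square algebra_simps)
    finally show "0 \<le> q * ((q - 1) * n t powr (q - 2) * n' t * n' t + n t powr (q - 1) * (2 * (norm z)\<^sup>2)) - m"
      by simp
  qed simp
  from convex_onD[OF this, of "1/2" "-1" 1]
  have "2 * f 0 \<le> f (-1) + f 1"
    by simp
  then show ?thesis
    unfolding f_def n_eq by (simp add: m_def q_def algebra_simps)
qed

text \<open>Limit of the regularized inequality as \<open>e\<close> decreases to 0. The case
  \<open>z = 0\<close> is separate because the power with exponent \<open>p / 2 - 1\<close> needs a
  positive base in the limit.\<close>

lemma convexity_pointwise: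
  fixes x z :: "'v::real_inner"
  assumes p: "1 < p" "p \<le> 2"
  shows "2 * norm x powr p + p * (p - 1) * ((norm x + norm z) powr (p - 2) * (norm z)\<^sup>2)
    \<le> norm (x + z) powr p + norm (x - z) powr p"
proof (cases "z = 0")
  case True
  then show ?thesis by simp
next
  case False
  let ?F = "at_right (0::real)"
  have s: "0 < norm x + norm z" using False by (simp add: add_nonneg_pos)
  have lim: "((\<lambda>e. (a + e) powr (p / 2)) \<longlongrightarrow> a powr (p / 2)) ?F" if "0 \<le> a" for a :: real
  proof -
    have "((\<lambda>e. (a + e) powr (p / 2)) \<longlongrightarrow> (a + 0) powr (p / 2)) ?F"
      using p that by (intro tendsto_powr2 tendsto_intros) (auto simp: eventually_at_filter)
    then show ?thesis by simp
  qed
  have "((\<lambda>e. ((norm x + norm z)\<^sup>2 + e) powr (p / 2 - 1)) \<longlongrightarrow> ((norm x + norm z)\<^sup>2 + 0) powr (p / 2 - 1)) ?F"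
    using s by (intro tendsto_powr tendsto_intros) auto
  moreover have "((norm x + norm z)\<^sup>2 + 0) powr (p / 2 - 1) = (norm x + norm z) powr (p - 2)"
  proof -
    have "(norm x + norm z)\<^sup>2 = (norm x + norm z) powr 2"
      using s by (simp add: powr_numeral)
    then have "((norm x + norm z)\<^sup>2) powr (p / 2 - 1) = (norm x + norm z) powr (2 * (p / 2 - 1))"
      by (simp only: powr_powr)
    then show ?thesis
      by (simp add: right_diff_distrib)
  qed
  ultimately have lim2: "((\<lambda>e. ((norm x + norm z)\<^sup>2 + e) powr (p / 2 - 1)) \<longlongrightarrow> (norm x + norm z) powr (p - 2)) ?F"
    by simp
  have "2 * ((norm x)\<^sup>2) powr (p / 2) + p * (p - 1) * (norm x + norm z) powr (p - 2) * (norm z)\<^sup>2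
    \<le> ((norm (x + z))\<^sup>2) powr (p / 2) + ((norm (x - z))\<^sup>2) powr (p / 2)"
  proof (rule tendsto_le[of ?F])
    show "\<forall>\<^sub>F e in ?F. 2 * ((norm x)\<^sup>2 + e) powr (p / 2) + p * (p - 1) * ((norm x + norm z)\<^sup>2 + e) powr (p / 2 - 1) * (norm z)\<^sup>2
    \<le> ((norm (x + z))\<^sup>2 + e) powr (p / 2) + ((norm (x - z))\<^sup>2 + e) powr (p / 2)"
      using convexity_pointwise_regularized[OF p, of _ x z] by (auto simp: eventually_at_filter)
  qed (auto intro!: tendsto_intros lim lim2)
  then show ?thesis
    by (simp add: norm_powr_eq_power2_powr[of _ p] mult.assoc)
qed

section \<open>Uniform convexity and smoothness of Lebesgue spaces\<close>

lemma LpD: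
  assumes "f \<in> Lp M p"
  shows "f \<in> borel_measurable M" "integrable M (\<lambda>x. norm (f x) powr p)"
  using assms by (auto simp: Lp_def)

lemma Lp_norm_nonneg [simp]: "0 \<le> Lp_norm M p f"
  by (simp add: Lp_norm_def)

lemma Lp_norm_powr:
  assumes "0 < p"
  shows "Lp_norm M p f powr p = (LINT x|M. norm (f x) powr p)"
  using assms by (simp add: Lp_norm_def powr_powr)

lemma Lp_norm_le_iff:
  assumes "0 < p" "0 \<le> b"
  shows "Lp_norm M p f \<le> b \<longleftrightarrow> (LINT x|M. norm (f x) powr p) \<le> b powr p"
  using assms powr_le_iff[of b]
  by (metis Lp_norm_nonneg Lp_norm_powr powr_less_mono2 linorder_not_less powr_mono2 less_imp_le)

lemma Lp_norm_zero [simp]: "Lp_norm M p 0 = 0"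
  by (simp add: Lp_norm_def)

lemma Lp_zero [simp]: "0 \<in> Lp M p"
  by (simp add: Lp_def zero_fun_def)

lemma Lp_scaleR:
  assumes "f \<in> Lp M p"
  shows "(\<lambda>x. r *\<^sub>R f x) \<in> Lp M p"
  using LpD[OF assms] by (auto simp: Lp_def powr_mult)

lemma Lp_norm_scaleR:
  assumes "0 < p"
  shows "Lp_norm M p (\<lambda>x. r *\<^sub>R f x) = \<bar>r\<bar> * Lp_norm M p f"
  using assms by (simp add: Lp_norm_def powr_mult powr_powr)

lemma Lp_uminus:
  assumes "f \<in> Lp M p"
  shows "- f \<in> Lp M p"
  using Lp_scaleR[OF assms, of "-1"] by (simp add: fun_Compl_def)

lemma Lp_norm_uminus: "Lp_norm M p (- f) = Lp_norm M p f"
  by (simp add: Lp_norm_def)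

lemma Lp_norm_minus_commute: "Lp_norm M p (f - g) = Lp_norm M p (g - f)"
  by (simp add: Lp_norm_def norm_minus_commute)

lemma integrable_norm_add_powr:
  assumes p: "1 \<le> p" and fg: "f \<in> Lp M p" "g \<in> Lp M p"
  shows "integrable M (\<lambda>x. (norm (f x) + norm (g x)) powr p)"
    "(LINT x|M. (norm (f x) + norm (g x)) powr p) \<le> 2 powr (p - 1) * (Lp_norm M p f powr p + Lp_norm M p g powr p)"
proof -
  note [measurable] = LpD(1)[OF fg(1)] LpD(1)[OF fg(2)]
  note [simp] = LpD(2)[OF fg(1)] LpD(2)[OF fg(2)]
  show int: "integrable M (\<lambda>x. (norm (f x) + norm (g x)) powr p)"
  proof (rule Bochner_Integration.integrable_bound)
    show "integrable M (\<lambda>x. 2 powr (p - 1) * (norm (f x) powr p + norm (g x) powr p))"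
      by simp
    show "AE x in M. norm ((norm (f x) + norm (g x)) powr p)
        \<le> norm (2 powr (p - 1) * (norm (f x) powr p + norm (g x) powr p))"
      using powr_add_le_two_powr[OF p] by simp
  qed measurable
  have "(LINT x|M. (norm (f x) + norm (g x)) powr p)
      \<le> (LINT x|M. 2 powr (p - 1) * (norm (f x) powr p + norm (g x) powr p))"
    using int powr_add_le_two_powr[OF p] by (intro integral_mono) auto
  then show "(LINT x|M. (norm (f x) + norm (g x)) powr p)
      \<le> 2 powr (p - 1) * (Lp_norm M p f powr p + Lp_norm M p g powr p)"
    using p by (simp add: Lp_norm_powr)
qed

lemma Lp_add:
  assumes p: "1 \<le> p" and fg: "f \<in> Lp M p" "g \<in> Lp M p"
  shows "f + g \<in> Lp M p"
proof -
  note [measurable] = LpD(1)[OF fg(1)] LpD(1)[OF fg(2)]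
  have m: "f + g \<in> borel_measurable M"
    unfolding plus_fun_def by measurable
  have "integrable M (\<lambda>x. norm (f x + g x) powr p)"
    by (rule Bochner_Integration.integrable_bound[OF integrable_norm_add_powr(1)[OF p fg]])
      (use p in \<open>auto intro!: AE_I2 powr_mono2 norm_triangle_ineq\<close>)
  with m show ?thesis
    by (simp add: Lp_def)
qed

lemma Lp_diff:
  assumes "1 \<le> p" "f \<in> Lp M p" "g \<in> Lp M p"
  shows "f - g \<in> Lp M p"
  using Lp_add[OF assms(1,2) Lp_uminus[OF assms(3)]] by simp

lemma Lp_sum:
  assumes "1 \<le> p" "\<And>i. i \<in> S \<Longrightarrow> f i \<in> Lp M p"
  shows "(\<Sum>i\<in>S. f i) \<in> Lp M p"
  using assms(2) by (induction S rule: infinite_finite_induct) (auto intro: Lp_add[OF assms(1)])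

text \<open>For positive bounds \<open>a\<close> and \<open>b\<close> of the two norms,
  \<open>(f + g) / (a + b)\<close> is a convex combination of \<open>f / a\<close> and
  \<open>g / b\<close>, and convexity of the power is integrated. Bounds replace the norms
  themselves so that vanishing norms need no separate case; they are then lowered to the
  norms.\<close>

lemma Lp_Minkowski:
  fixes f g :: "'a \<Rightarrow> 'k::{real_normed_field, euclidean_space}"
  assumes p: "1 \<le> p" and fg: "f \<in> Lp M p" "g \<in> Lp M p"
  shows "Lp_norm M p (f + g) \<le> Lp_norm M p f + Lp_norm M p g"
proof -
  have *: "Lp_norm M p (f + g) \<le> a + b"
    if a: "0 < a" "Lp_norm M p f \<le> a" and b: "0 < b" "Lp_norm M p g \<le> b" for a b
  proof -
    have ab: "a / (a + b) + b / (a + b) = 1"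
      using a b by (simp flip: add_divide_distrib)
    have pw: "norm (f x + g x) powr p
        \<le> (a + b) powr p * (a / (a + b) * (norm (f x) powr p / a powr p) + b / (a + b) * (norm (g x) powr p / b powr p))"
      for x
    proof -
      have "norm (f x + g x) powr p \<le> (norm (f x) + norm (g x)) powr p"
        using p norm_triangle_ineq by (intro powr_mono2) auto
      also have "norm (f x) + norm (g x) = (a + b) * (a / (a + b) * (norm (f x) / a) + b / (a + b) * (norm (g x) / b))"
      proof -
        have "a / (a + b) * (norm (f x) / a) = norm (f x) / (a + b)" "b / (a + b) * (norm (g x) / b) = norm (g x) / (a + b)"
          using a b by auto
        then show ?thesis
          using a b by (simp flip: add_divide_distrib)
      qed
      also have "\<dots> powr p = (a + b) powr p * (a / (a + b) * (norm (f x) / a) + b / (a + b) * (norm (g x) / b)) powr p"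
        by (rule powr_mult)
      also have "\<dots> \<le> (a + b) powr p * (a / (a + b) * (norm (f x) / a) powr p + b / (a + b) * (norm (g x) / b) powr p)"
        using convex_onD[OF convex_on_powr_nonneg[OF p], of "b / (a + b)" "norm (f x) / a" "norm (g x) / b"] a b ab
        by (intro mult_left_mono) (auto simp: eq_diff_eq[symmetric])
      finally show ?thesis
        using a b by (simp add: powr_divide)
    qed
    have "(LINT x|M. norm ((f + g) x) powr p)
        \<le> (LINT x|M. (a + b) powr p * (a / (a + b) * (norm (f x) powr p / a powr p) + b / (a + b) * (norm (g x) powr p / b powr p)))"
      using pw LpD(2)[OF Lp_add[OF p fg]] LpD(2)[OF fg(1)] LpD(2)[OF fg(2)] by (intro integral_mono) auto
    also have "\<dots> = (a + b) powr p * (a / (a + b) * (Lp_norm M p f powr p / a powr p) + b / (a + b) * (Lp_norm M p g powr p / b powr p))"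
      using LpD(2)[OF fg(1)] LpD(2)[OF fg(2)] p by (simp add: Lp_norm_powr)
    also have "\<dots> \<le> (a + b) powr p * (a / (a + b) * 1 + b / (a + b) * 1)"
      using a b p by (intro mult_left_mono add_mono) (auto intro!: powr_mono2 simp: divide_le_eq_1)
    also have "\<dots> = (a + b) powr p"
      using ab by simp
    finally show ?thesis
      using a b p by (simp add: Lp_norm_le_iff)
  qed
  show ?thesis
  proof (rule field_le_epsilon)
    fix e :: real assume "0 < e"
    then show "Lp_norm M p (f + g) \<le> Lp_norm M p f + Lp_norm M p g + e"
      using *[of "Lp_norm M p f + e / 2" "Lp_norm M p g + e / 2"] by (simp add: add_nonneg_pos)
  qed
qed

lemma Lp_norm_diff_triangle:
  assumes "1 \<le> p" "f \<in> Lp M p" "g \<in> Lp M p" "h \<in> Lp M p"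
  shows "Lp_norm M p (f - h) \<le> Lp_norm M p (f - g) + Lp_norm M p (g - h)"
  using Lp_Minkowski[OF assms(1) Lp_diff[OF assms(1-3)] Lp_diff[OF assms(1,3,4)]] by simp

lemma Lp_norm_sum_le:
  assumes "1 \<le> p" "\<And>i. i \<in> S \<Longrightarrow> f i \<in> Lp M p"
  shows "Lp_norm M p (\<Sum>i\<in>S. f i) \<le> (\<Sum>i\<in>S. Lp_norm M p (f i))"
  using assms(2)
proof (induction S rule: infinite_finite_induct)
  case (insert i S)
  have "Lp_norm M p (f i + (\<Sum>j\<in>S. f j)) \<le> Lp_norm M p (f i) + Lp_norm M p (\<Sum>j\<in>S. f j)"
    using insert.prems by (intro Lp_Minkowski Lp_sum assms(1)) auto
  also have "\<dots> \<le> Lp_norm M p (f i) + (\<Sum>j\<in>S. Lp_norm M p (f j))"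
    using insert.prems by (intro add_left_mono insert.IH) auto
  finally show ?case
    by (simp only: sum.insert[OF insert.hyps])
qed auto

text \<open>Minkowski's inequality followed by convexity of the power. It is applied where an
  approximation error is split into a convex combination with freely chosen weights.\<close>

lemma Lp_norm_powr_Jensen:
  assumes p: "1 \<le> p" and \<theta>: "1 \<le> \<theta>" and "finite S" "S \<noteq> {}"
    and f: "\<And>i. i \<in> S \<Longrightarrow> f i \<in> Lp M p"
    and w: "\<And>i. i \<in> S \<Longrightarrow> 0 \<le> w i" "(\<Sum>i\<in>S. w i) = 1"
  shows "Lp_norm M p (\<Sum>i\<in>S. (\<lambda>x. w i *\<^sub>R f i x)) powr \<theta> \<le> (\<Sum>i\<in>S. w i * Lp_norm M p (f i) powr \<theta>)"
proof -
  have "Lp_norm M p (\<Sum>i\<in>S. (\<lambda>x. w i *\<^sub>R f i x)) \<le> (\<Sum>i\<in>S. Lp_norm M p (\<lambda>x. w i *\<^sub>R f i x))"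
    using f by (intro Lp_norm_sum_le p Lp_scaleR)
  also have "\<dots> = (\<Sum>i\<in>S. w i * Lp_norm M p (f i))"
    using p w(1) by (intro sum.cong) (auto simp: Lp_norm_scaleR)
  finally have "Lp_norm M p (\<Sum>i\<in>S. (\<lambda>x. w i *\<^sub>R f i x)) powr \<theta> \<le> (\<Sum>i\<in>S. w i * Lp_norm M p (f i)) powr \<theta>"
    using \<theta> by (intro powr_mono2) auto
  also have "\<dots> \<le> (\<Sum>i\<in>S. w i * Lp_norm M p (f i) powr \<theta>)"
    using convex_on_sum[OF assms(3,4) convex_on_powr_nonneg[OF \<theta>] w(2,1), of "\<lambda>i. Lp_norm M p (f i)"] by simp
  finally show ?thesis .
qed

text \<open>After normalizing both integrals to 1, Young's inequality is integrated. A vanishing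
  integral is separate, since it forces the product to vanish almost everywhere.\<close>

lemma Hoelder_integral:
  fixes F G :: "'a \<Rightarrow> real"
  assumes \<kappa>: "0 < \<kappa>" "\<kappa> < 1" and F: "integrable M F" "\<And>x. 0 \<le> F x" and G: "integrable M G" "\<And>x. 0 \<le> G x"
  shows "integrable M (\<lambda>x. F x powr \<kappa> * G x powr (1 - \<kappa>))"
    "(LINT x|M. F x powr \<kappa> * G x powr (1 - \<kappa>)) \<le> (LINT x|M. F x) powr \<kappa> * (LINT x|M. G x) powr (1 - \<kappa>)"
proof -
  note [measurable] = borel_measurable_integrable[OF F(1)] borel_measurable_integrable[OF G(1)]
  note [simp] = F G
  show int: "integrable M (\<lambda>x. F x powr \<kappa> * G x powr (1 - \<kappa>))"
  proof (rule Bochner_Integration.integrable_bound)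
    show "integrable M (\<lambda>x. \<kappa> * F x + (1 - \<kappa>) * G x)"
      by simp
    show "AE x in M. norm (F x powr \<kappa> * G x powr (1 - \<kappa>)) \<le> norm (\<kappa> * F x + (1 - \<kappa>) * G x)"
      using powr_Young[OF \<kappa>] \<kappa> by (auto intro!: AE_I2)
  qed measurable
  define A B where "A = (LINT x|M. F x)" and "B = (LINT x|M. G x)"
  have AB: "0 \<le> A" "0 \<le> B"
    by (auto simp: A_def B_def)
  show "(LINT x|M. F x powr \<kappa> * G x powr (1 - \<kappa>)) \<le> (LINT x|M. F x) powr \<kappa> * (LINT x|M. G x) powr (1 - \<kappa>)"
  proof (cases "A = 0 \<or> B = 0")
    case True
    then have "(AE x in M. F x = 0) \<or> (AE x in M. G x = 0)"
      unfolding A_def B_def by (subst (asm) (1 2) integral_nonneg_eq_0_iff_AE) auto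
    then have "AE x in M. F x powr \<kappa> * G x powr (1 - \<kappa>) = 0"
      by auto
    then have "(LINT x|M. F x powr \<kappa> * G x powr (1 - \<kappa>)) = 0"
      by (rule integral_eq_zero_AE)
    then show ?thesis
      by simp
  next
    case False
    then have pos: "0 < A" "0 < B" using AB by auto
    have pw: "F x powr \<kappa> * G x powr (1 - \<kappa>) \<le> A powr \<kappa> * B powr (1 - \<kappa>) * (\<kappa> * (F x / A) + (1 - \<kappa>) * (G x / B))" for x
    proof -
      have "F x powr \<kappa> * G x powr (1 - \<kappa>)
          = A powr \<kappa> * B powr (1 - \<kappa>) * ((F x / A) powr \<kappa> * (G x / B) powr (1 - \<kappa>))"
        using pos by (simp add: powr_divide)
      also have "\<dots> \<le> A powr \<kappa> * B powr (1 - \<kappa>) * (\<kappa> * (F x / A) + (1 - \<kappa>) * (G x / B))"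
        using pos by (intro mult_left_mono powr_Young \<kappa>) auto
      finally show ?thesis .
    qed
    have "(LINT x|M. F x powr \<kappa> * G x powr (1 - \<kappa>))
        \<le> (LINT x|M. A powr \<kappa> * B powr (1 - \<kappa>) * (\<kappa> * (F x / A) + (1 - \<kappa>) * (G x / B)))"
      using int pw by (intro integral_mono) auto
    also have "\<dots> = A powr \<kappa> * B powr (1 - \<kappa>) * (\<kappa> * (A / A) + (1 - \<kappa>) * (B / B))"
      by (simp add: A_def B_def)
    also have "\<dots> = A powr \<kappa> * B powr (1 - \<kappa>)"
      using pos by simp
    finally show ?thesis
      unfolding A_def B_def .
  qed
qed

section \<open>Uniform convexity, for pairs whose midpoint is at least as large as
  \<open>u\<close>\<close>

lemma Lp_uniform_convexity_ge2:
  fixes u v :: "'a \<Rightarrow> 'k::{real_normed_field, euclidean_space}"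
  assumes p: "2 \<le> p" and uv: "u \<in> Lp M p" "v \<in> Lp M p"
    and mid: "Lp_norm M p u \<le> Lp_norm M p (\<lambda>x. (1/2) *\<^sub>R (u x + v x))"
  shows "Lp_norm M p (u - v) powr p \<le> 2 powr (p - 1) * (Lp_norm M p v powr p - Lp_norm M p u powr p)"
proof -
  have p1: "1 \<le> p" "0 < p" using p by auto
  define x z where "x = (\<lambda>y. (1/2) *\<^sub>R (u + v) y)" and "z = (\<lambda>y. (1/2) *\<^sub>R (u - v) y)"
  have xz: "x \<in> Lp M p" "z \<in> Lp M p"
    unfolding x_def z_def by (intro Lp_scaleR Lp_add Lp_diff p1 uv)+
  have sd: "x y + z y = u y" "x y - z y = v y" for y
    by (simp_all add: x_def z_def scaleR_right_distrib scaleR_right_diff_distrib flip: scaleR_left_distrib)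
  have "2 * norm (x y) powr p + 2 * norm (z y) powr p \<le> norm (u y) powr p + norm (v y) powr p" for y
    using Clarkson_pointwise_ge[OF p, of "x y" "z y"] by (simp only: sd)
  then have "(LINT y|M. 2 * norm (x y) powr p + 2 * norm (z y) powr p)
      \<le> (LINT y|M. norm (u y) powr p + norm (v y) powr p)"
    using LpD(2)[OF uv(1)] LpD(2)[OF uv(2)] LpD(2)[OF xz(1)] LpD(2)[OF xz(2)]
    by (intro integral_mono) auto
  then have "2 * Lp_norm M p x powr p + 2 * Lp_norm M p z powr p \<le> Lp_norm M p u powr p + Lp_norm M p v powr p"
    using LpD(2)[OF uv(1)] LpD(2)[OF uv(2)] LpD(2)[OF xz(1)] LpD(2)[OF xz(2)] p1 by (simp add: Lp_norm_powr)
  \<comment> \<open>Of the two copies of the midpoint term, one cancels the \<open>u\<close> term on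
    the right and the other supplies the subtracted one.\<close>
  moreover have "Lp_norm M p u powr p \<le> Lp_norm M p x powr p"
    using mid p1 by (intro powr_mono2) (auto simp: x_def)
  moreover have "Lp_norm M p (u - v) powr p = 2 powr p * Lp_norm M p z powr p"
  proof -
    have "Lp_norm M p (u - v) = 2 * Lp_norm M p z"
      using Lp_norm_scaleR[OF p1(2), of M "1/2" "u - v"] by (simp add: z_def)
    then show ?thesis
      by (simp only: powr_mult)
  qed
  ultimately have "Lp_norm M p (u - v) powr p \<le> 2 powr p * ((Lp_norm M p v powr p - Lp_norm M p u powr p) / 2)"
    by (auto intro!: mult_left_mono)
  then show ?thesis
    by (simp add: powr_diff)
qed

text \<open>Integrating the pointwise inequality controls only the weighted integral
  \<open>\<Psi>\<close> of the squared half-difference. Hoelder's inequality with exponents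
  \<open>p / 2\<close> and \<open>1 - p / 2\<close> removes the weight, at the price of the integral
  of \<open>W powr p\<close>, which is at most \<open>(2 * V) powr p\<close>.\<close>

lemma Lp_uniform_convexity_less2:
  fixes u v :: "'a \<Rightarrow> 'k::{real_normed_field, euclidean_space}"
  assumes p: "1 < p" "p < 2" and uv: "u \<in> Lp M p" "v \<in> Lp M p"
    and le: "Lp_norm M p u \<le> Lp_norm M p v"
    and mid: "Lp_norm M p u \<le> Lp_norm M p (\<lambda>x. (1/2) *\<^sub>R (u x + v x))"
  shows "Lp_norm M p (u - v) powr 2
    \<le> 4 * 2 powr (2 - p) / (p * (p - 1)) * (Lp_norm M p v powr 2 - Lp_norm M p u powr 2)"
proof -
  have p1: "1 \<le> p" "0 < p" using p by auto
  define x z where "x = (\<lambda>y. (1/2) *\<^sub>R (u + v) y)" and "z = (\<lambda>y. (1/2) *\<^sub>R (u - v) y)"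
  have xz: "x \<in> Lp M p" "z \<in> Lp M p"
    unfolding x_def z_def by (intro Lp_scaleR Lp_add Lp_diff p1 uv)+
  note [measurable] = LpD(1)[OF xz(1)] LpD(1)[OF xz(2)]
  note [simp] = LpD(2)[OF uv(1)] LpD(2)[OF uv(2)] LpD(2)[OF xz(1)] LpD(2)[OF xz(2)]
  have sd: "x y + z y = u y" "x y - z y = v y" for y
    by (simp_all add: x_def z_def scaleR_right_distrib scaleR_right_diff_distrib flip: scaleR_left_distrib)
  define W where "W = (\<lambda>y. norm (x y) + norm (z y))"
  define U V Z \<Psi> where "U = Lp_norm M p u" and "V = Lp_norm M p v" and "Z = Lp_norm M p z"
    and "\<Psi> = (LINT y|M. W y powr (p - 2) * (norm (z y))\<^sup>2)"
  have nonneg: "0 \<le> U" "0 \<le> V" "0 \<le> Z" "0 \<le> \<Psi>" "U \<le> V"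
    using le by (auto simp: U_def V_def Z_def \<Psi>_def)
  have [measurable]: "W \<in> borel_measurable M"
    unfolding W_def by measurable
  have int\<Psi>: "integrable M (\<lambda>y. W y powr (p - 2) * (norm (z y))\<^sup>2)"
  proof (rule Bochner_Integration.integrable_bound[OF LpD(2)[OF xz(2)]])
    have "W y powr (p - 2) * (norm (z y))\<^sup>2 \<le> norm (z y) powr p" for y
    proof (cases "z y = 0")
      case False
      have "W y powr (p - 2) * (norm (z y))\<^sup>2 \<le> norm (z y) powr (p - 2) * (norm (z y))\<^sup>2"
        using False p by (intro mult_right_mono powr_mono2') (auto simp: W_def)
      also have "\<dots> = norm (z y) powr p"
        using False by (simp add: powr_diff power2_eq_square)
      finally show ?thesis .
    qed simp
    then show "AE y in M. norm (W y powr (p - 2) * (norm (z y))\<^sup>2) \<le> norm (norm (z y) powr p)"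
      by simp
  qed measurable
  have "2 * norm (x y) powr p + p * (p - 1) * (W y powr (p - 2) * (norm (z y))\<^sup>2)
      \<le> norm (u y) powr p + norm (v y) powr p" for y
    using convexity_pointwise[of p "x y" "z y"] p by (simp only: sd W_def)
  then have "(LINT y|M. 2 * norm (x y) powr p + p * (p - 1) * (W y powr (p - 2) * (norm (z y))\<^sup>2))
      \<le> (LINT y|M. norm (u y) powr p + norm (v y) powr p)"
    using int\<Psi> by (intro integral_mono) auto
  then have "2 * Lp_norm M p x powr p + p * (p - 1) * \<Psi> \<le> U powr p + V powr p"
    using p1 int\<Psi> by (simp add: Lp_norm_powr \<Psi>_def U_def V_def)
  moreover have "U powr p \<le> Lp_norm M p x powr p"
    using mid p1 by (intro powr_mono2) (auto simp: x_def U_def)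
  ultimately have "p * (p - 1) * \<Psi> \<le> V powr p - U powr p"
    by linarith
  then have \<Psi>: "\<Psi> \<le> (V powr p - U powr p) / (p * (p - 1))"
    using p by (simp add: pos_le_divide_eq mult.commute)
  have xV: "Lp_norm M p x \<le> V"
    unfolding x_def using Lp_norm_scaleR[OF p1(2), of M "1/2" "u + v"] Lp_Minkowski[OF p1(1) uv] nonneg
    by (simp add: U_def V_def)
  have zV: "Z \<le> V"
    unfolding Z_def z_def using Lp_norm_scaleR[OF p1(2), of M "1/2" "u - v"]
      Lp_Minkowski[OF p1(1) uv(1) Lp_uminus[OF uv(2)]] nonneg
    by (simp add: U_def V_def Lp_norm_uminus)
  have "(LINT y|M. W y powr p) \<le> 2 powr (p - 1) * (Lp_norm M p x powr p + Z powr p)"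
    unfolding W_def Z_def by (rule integrable_norm_add_powr(2)[OF p1(1) xz])
  also have "\<dots> \<le> 2 powr (p - 1) * (V powr p + V powr p)"
    using p1 xV zV nonneg by (intro mult_left_mono add_mono powr_mono2) auto
  also have "\<dots> = (2 * V) powr p"
    using nonneg by (simp add: powr_mult powr_diff)
  finally have W: "(LINT y|M. W y powr p) \<le> (2 * V) powr p" .
  \<comment> \<open>The weight cancels: its power \<open>(p - 2) * (p / 2)\<close> and the power
    \<open>p * (1 - p / 2)\<close> add up to zero.\<close>
  have eq: "(W y powr (p - 2) * (norm (z y))\<^sup>2) powr (p / 2) * (W y powr p) powr (1 - p / 2) = norm (z y) powr p" for y
  proof (cases "W y = 0")
    case True
    then have "z y = 0"
      by (simp add: W_def add_nonneg_eq_0_iff)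
    then show ?thesis by simp
  next
    case False
    then have "0 < W y" by (auto simp: W_def order_less_le)
    then show ?thesis
      by (simp add: powr_mult powr_powr norm_powr_eq_power2_powr[of _ p] field_simps flip: powr_add)
  qed
  have "Z powr p = (LINT y|M. (W y powr (p - 2) * (norm (z y))\<^sup>2) powr (p / 2) * (W y powr p) powr (1 - p / 2))"
    unfolding eq Z_def using p1 by (simp add: Lp_norm_powr)
  also have "\<dots> \<le> \<Psi> powr (p / 2) * (LINT y|M. W y powr p) powr (1 - p / 2)"
    unfolding \<Psi>_def
    using p int\<Psi> integrable_norm_add_powr(1)[OF p1(1) xz] by (intro Hoelder_integral) (auto simp: W_def)
  also have "\<dots> \<le> \<Psi> powr (p / 2) * ((2 * V) powr p) powr (1 - p / 2)"
    using p W by (intro mult_left_mono powr_mono2) auto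
  finally have "(Z powr p) powr (2 / p) \<le> (\<Psi> powr (p / 2) * ((2 * V) powr p) powr (1 - p / 2)) powr (2 / p)"
    using p by (intro powr_mono2) auto
  also have "\<dots> = \<Psi> * (2 * V) powr (2 - p)"
  proof -
    have "p / 2 * (2 / p) = 1" "p * (1 - p / 2) * (2 / p) = 2 - p"
      using p by (auto simp: field_simps)
    then show ?thesis
      using nonneg by (simp only: powr_mult powr_powr) simp
  qed
  also have "(Z powr p) powr (2 / p) = Z powr 2"
    using p by (simp only: powr_powr) simp
  finally have "Z powr 2 \<le> \<Psi> * (2 * V) powr (2 - p)" .
  also have "\<dots> \<le> (V powr p - U powr p) / (p * (p - 1)) * (2 * V) powr (2 - p)"
    using \<Psi> by (intro mult_right_mono) auto
  also have "\<dots> = 2 powr (2 - p) / (p * (p - 1)) * (V powr p * V powr (2 - p) - U powr p * V powr (2 - p))"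
    using nonneg by (simp only: powr_mult) (simp add: diff_divide_distrib algebra_simps)
  \<comment> \<open>As \<open>U \<le> V\<close>, lowering \<open>V\<close> to \<open>U\<close> in
    the subtracted product turns the difference of \<open>p\<close>-th powers into one of
    squares.\<close>
  also have "\<dots> \<le> 2 powr (2 - p) / (p * (p - 1)) * (V powr p * V powr (2 - p) - U powr p * U powr (2 - p))"
    using nonneg p by (intro mult_left_mono diff_left_mono powr_mono2) auto
  also have "\<dots> = 2 powr (2 - p) / (p * (p - 1)) * (V powr 2 - U powr 2)"
    by (simp only: powr_add[symmetric]) simp
  finally have "Z powr 2 \<le> 2 powr (2 - p) / (p * (p - 1)) * (V powr 2 - U powr 2)" .
  moreover have "Lp_norm M p (u - v) powr 2 = 4 * Z powr 2"
  proof -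
    have "Lp_norm M p (u - v) = 2 * Z"
      using Lp_norm_scaleR[OF p1(2), of M "1/2" "u - v"] by (simp add: Z_def z_def)
    then show ?thesis
      by (simp add: powr_mult)
  qed
  ultimately show ?thesis
    by (simp add: U_def V_def)
qed

lemma Lp_uniform_convexity:
  fixes M :: "'a measure"
  assumes p: "1 < p"
  obtains C where "0 < C"
    "\<And>u v :: 'a \<Rightarrow> 'k::{real_normed_field, euclidean_space}. u \<in> Lp M p \<Longrightarrow> v \<in> Lp M p \<Longrightarrow>
       Lp_norm M p u \<le> Lp_norm M p v \<Longrightarrow> Lp_norm M p u \<le> Lp_norm M p (\<lambda>x. (1/2) *\<^sub>R (u x + v x)) \<Longrightarrow>
       Lp_norm M p (u - v) powr max 2 p \<le> C * (Lp_norm M p v powr max 2 p - Lp_norm M p u powr max 2 p)"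
proof (cases "2 \<le> p")
  case True
  show ?thesis
    by (rule that[of "2 powr (p - 1)"]) (use True in \<open>auto simp: max_def intro: Lp_uniform_convexity_ge2\<close>)
next
  case False
  show ?thesis
  proof (rule that[of "4 * 2 powr (2 - p) / (p * (p - 1))"])
    show "0 < 4 * 2 powr (2 - p) / (p * (p - 1))"
      using p by simp
  next
    fix u v :: "'a \<Rightarrow> 'k"
    assume "u \<in> Lp M p" "v \<in> Lp M p" "Lp_norm M p u \<le> Lp_norm M p v"
      "Lp_norm M p u \<le> Lp_norm M p (\<lambda>x. (1/2) *\<^sub>R (u x + v x))"
    then show "Lp_norm M p (u - v) powr max 2 p
        \<le> 4 * 2 powr (2 - p) / (p * (p - 1)) * (Lp_norm M p v powr max 2 p - Lp_norm M p u powr max 2 p)"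
      using Lp_uniform_convexity_less2[of p u M v] p False by (simp only: max_def if_False)
  qed
qed

section \<open>Uniform smoothness with exponent \<open>min 2 p\<close>\<close>

lemma Lp_uniform_smoothness_le2:
  fixes x z :: "'a \<Rightarrow> 'k::{real_normed_field, euclidean_space}"
  assumes p: "1 \<le> p" "p \<le> 2" and xz: "x \<in> Lp M p" "z \<in> Lp M p"
  shows "Lp_norm M p (x + z) powr p + Lp_norm M p (x - z) powr p
    \<le> 2 * Lp_norm M p x powr p + 2 * Lp_norm M p z powr p"
proof -
  note [simp] = LpD(2)[OF xz(1)] LpD(2)[OF xz(2)]
    LpD(2)[OF Lp_add[OF p(1) xz], simplified] LpD(2)[OF Lp_diff[OF p(1) xz], simplified]
  have "(LINT y|M. norm (x y + z y) powr p + norm (x y - z y) powr p)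
      \<le> (LINT y|M. 2 * norm (x y) powr p + 2 * norm (z y) powr p)"
    using p by (intro integral_mono Clarkson_pointwise_le) auto
  then show ?thesis
    using p by (simp add: Lp_norm_powr)
qed

text \<open>Hoelder's inequality bounds the integrated remainder by
  \<open>(X + Z) powr (q - 1) * Z\<close> up to a constant, in terms of squared norms. This fits
  below the power \<open>(X + K * Z) powr q\<close>, and convexity of the power on the left allows
  the exponent \<open>q\<close> to be removed.\<close>

lemma Lp_uniform_smoothness_gt2:
  fixes M :: "'a measure"
  assumes p: "2 < p"
  obtains C where "0 \<le> C"
    "\<And>x z :: 'a \<Rightarrow> 'k::{real_normed_field, euclidean_space}. x \<in> Lp M p \<Longrightarrow> z \<in> Lp M p \<Longrightarrow>
      Lp_norm M p (x + z) powr 2 + Lp_norm M p (x - z) powr 2 \<le> 2 * Lp_norm M p x powr 2 + C * Lp_norm M p z powr 2"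
proof -
  have p1: "1 \<le> p" "0 < p" using p by auto
  define q where "q = p / 2"
  have q: "1 < q" using p by (simp add: q_def)
  obtain C where C: "0 \<le> C"
    "\<And>x z :: 'k. norm (x + z) powr p + norm (x - z) powr p
       \<le> 2 * norm x powr p + C * (((norm x)\<^sup>2 + (norm z)\<^sup>2) powr (p / 2 - 1) * (norm z)\<^sup>2)"
    using smoothness_pointwise[of p] p by (metis less_imp_le)
  define \<kappa> where "\<kappa> = (p - 2) / p"
  have \<kappa>: "0 < \<kappa>" "\<kappa> < 1" "q * \<kappa> = q - 1" "p * (1 - \<kappa>) = 2" "p * \<kappa> = p - 2"
    using p by (auto simp: \<kappa>_def q_def field_simps)
  \<comment> \<open>Half the constant produced by Hoelder's inequality, matching the factor 2 in
    front of \<open>X powr q\<close>; the maximum with 1 ensures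
    \<open>X + Z \<le> X + K * Z\<close>.\<close>
  define K where "K = max 1 (C * (2 powr (q - 1)) powr \<kappa> / 2)"
  have "Lp_norm M p (x + z) powr 2 + Lp_norm M p (x - z) powr 2 \<le> 2 * Lp_norm M p x powr 2 + (2 * K) * Lp_norm M p z powr 2"
    if xz: "x \<in> Lp M p" "z \<in> Lp M p" for x z :: "'a \<Rightarrow> 'k"
  proof -
    note [measurable] = LpD(1)[OF xz(1)] LpD(1)[OF xz(2)]
    note [simp] = LpD(2)[OF xz(1)] LpD(2)[OF xz(2)]
      LpD(2)[OF Lp_add[OF p1(1) xz], simplified] LpD(2)[OF Lp_diff[OF p1(1) xz], simplified]
    define F where "F = (\<lambda>y. ((norm (x y))\<^sup>2 + (norm (z y))\<^sup>2) powr q)"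
    have [measurable]: "F \<in> borel_measurable M"
      unfolding F_def by measurable
    have Fb: "F y \<le> 2 powr (q - 1) * (norm (x y) powr p + norm (z y) powr p)" for y
      using powr_add_le_two_powr[of q "(norm (x y))\<^sup>2" "(norm (z y))\<^sup>2"] q
      by (simp add: F_def norm_powr_eq_power2_powr[of _ p] q_def)
    have intF: "integrable M F"
    proof (rule Bochner_Integration.integrable_bound)
      show "integrable M (\<lambda>y. 2 powr (q - 1) * (norm (x y) powr p + norm (z y) powr p))"
        by simp
      show "AE y in M. norm (F y) \<le> norm (2 powr (q - 1) * (norm (x y) powr p + norm (z y) powr p))"
        using Fb by (simp add: F_def)
    qed measurable
    define X Z U V where "X = Lp_norm M p x powr 2" and "Z = Lp_norm M p z powr 2"
      and "U = Lp_norm M p (x + z) powr 2" and "V = Lp_norm M p (x - z) powr 2"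
    have nn: "0 \<le> X" "0 \<le> Z" "0 \<le> U" "0 \<le> V"
      by (auto simp: X_def Z_def U_def V_def)
    have pq: "(a powr 2) powr q = a powr p" for a :: real
      by (simp only: powr_powr q_def) simp
    have F_eq: "F y powr \<kappa> * (norm (z y) powr p) powr (1 - \<kappa>)
        = ((norm (x y))\<^sup>2 + (norm (z y))\<^sup>2) powr (p / 2 - 1) * (norm (z y))\<^sup>2" for y
      unfolding F_def powr_powr \<kappa>(3,4) by (simp add: q_def)
    have "(LINT y|M. F y) \<le> (LINT y|M. 2 powr (q - 1) * (norm (x y) powr p + norm (z y) powr p))"
      using intF Fb by (intro integral_mono) auto
    also have "\<dots> = 2 powr (q - 1) * (X powr q + Z powr q)"
      using p1 by (simp add: Lp_norm_powr X_def Z_def pq del: powr_numeral)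
    also have "\<dots> \<le> 2 powr (q - 1) * (X + Z) powr q"
      using q nn by (intro mult_left_mono powr_add_ge) auto
    finally have F: "(LINT y|M. F y) \<le> 2 powr (q - 1) * (X + Z) powr q" .
    have Hi: "integrable M (\<lambda>y. ((norm (x y))\<^sup>2 + (norm (z y))\<^sup>2) powr (p / 2 - 1) * (norm (z y))\<^sup>2)"
      using Hoelder_integral(1)[OF \<kappa>(1,2) intF _ LpD(2)[OF xz(2)]] unfolding F_eq by (simp add: F_def)
    have "(LINT y|M. ((norm (x y))\<^sup>2 + (norm (z y))\<^sup>2) powr (p / 2 - 1) * (norm (z y))\<^sup>2)
        \<le> (LINT y|M. F y) powr \<kappa> * (LINT y|M. norm (z y) powr p) powr (1 - \<kappa>)"
      using Hoelder_integral(2)[OF \<kappa>(1,2) intF _ LpD(2)[OF xz(2)]] unfolding F_eq by (simp add: F_def)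
    also have "(LINT y|M. norm (z y) powr p) powr (1 - \<kappa>) = Z"
      using p1 by (simp add: Z_def powr_powr \<kappa> flip: Lp_norm_powr del: powr_numeral)
    also have "(LINT y|M. F y) powr \<kappa> * Z \<le> (2 powr (q - 1) * (X + Z) powr q) powr \<kappa> * Z"
      using F \<kappa> nn by (intro mult_right_mono powr_mono2) (auto simp: F_def)
    also have "\<dots> = (2 powr (q - 1)) powr \<kappa> * (X + Z) powr (q - 1) * Z"
      using nn by (simp add: powr_mult powr_powr \<kappa>)
    finally have H: "(LINT y|M. ((norm (x y))\<^sup>2 + (norm (z y))\<^sup>2) powr (p / 2 - 1) * (norm (z y))\<^sup>2)
        \<le> (2 powr (q - 1)) powr \<kappa> * (X + Z) powr (q - 1) * Z" .
    have "(LINT y|M. norm (x y + z y) powr p + norm (x y - z y) powr p)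
      \<le> (LINT y|M. 2 * norm (x y) powr p + C * (((norm (x y))\<^sup>2 + (norm (z y))\<^sup>2) powr (p / 2 - 1) * (norm (z y))\<^sup>2))"
      using C Hi by (intro integral_mono) auto
    then have "U powr q + V powr q
        \<le> 2 * X powr q + C * (LINT y|M. ((norm (x y))\<^sup>2 + (norm (z y))\<^sup>2) powr (p / 2 - 1) * (norm (z y))\<^sup>2)"
      using Hi p1 by (simp add: U_def V_def X_def pq Lp_norm_powr del: powr_numeral)
    also have "\<dots> \<le> 2 * X powr q + C * ((2 powr (q - 1)) powr \<kappa> * (X + Z) powr (q - 1) * Z)"
      using C(1) H by (intro add_left_mono mult_left_mono) auto
    also have "\<dots> = 2 * X powr q + 2 * (C * (2 powr (q - 1)) powr \<kappa> / 2 * ((X + Z) powr (q - 1) * Z))"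
      by simp
    also have "\<dots> \<le> 2 * X powr q + 2 * (K * ((X + Z) powr (q - 1) * Z))"
      using nn by (intro add_left_mono mult_left_mono mult_right_mono) (auto simp: K_def)
    finally have UV: "U powr q + V powr q \<le> 2 * (X powr q + K * ((X + Z) powr (q - 1) * Z))"
      by simp
    have "((U + V) / 2) powr q \<le> (U powr q + V powr q) / 2"
      using q nn by (intro powr_mean_le) auto
    also have "\<dots> \<le> X powr q + K * ((X + Z) powr (q - 1) * Z)"
      using UV by simp
    also have "\<dots> = X * X powr (q - 1) + K * Z * (X + Z) powr (q - 1)"
      using nn powr_mult_self[of X q] by simp
    also have "\<dots> \<le> X * (X + K * Z) powr (q - 1) + K * Z * (X + K * Z) powr (q - 1)"
    proof -
      have "Z \<le> K * Z"
        using mult_right_mono[of 1 K Z] nn by (simp add: K_def)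
      then have "X powr (q - 1) \<le> (X + K * Z) powr (q - 1)" "(X + Z) powr (q - 1) \<le> (X + K * Z) powr (q - 1)"
        using nn q by (auto intro!: powr_mono2)
      then show ?thesis
        using nn by (intro add_mono mult_left_mono) (auto simp: K_def)
    qed
    also have "\<dots> = (X + K * Z) powr q"
      using nn powr_mult_self[of "X + K * Z" q] by (simp add: K_def distrib_right)
    finally have le: "((U + V) / 2) powr q \<le> (X + K * Z) powr q" .
    have "(U + V) / 2 \<le> X + K * Z"
    proof (rule ccontr)
      assume "\<not> (U + V) / 2 \<le> X + K * Z"
      then have "(X + K * Z) powr q < ((U + V) / 2) powr q"
        using nn q by (intro powr_less_mono2) (auto simp: K_def)
      with le show False
        by simp
    qed
    then show ?thesis
      by (simp add: U_def V_def X_def Z_def)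
  qed
  then show ?thesis
    using that[of "2 * K"] by (simp add: K_def)
qed

lemma Lp_uniform_smoothness:
  fixes M :: "'a measure"
  assumes p: "1 < p"
  obtains C where "0 \<le> C"
    "\<And>x z :: 'a \<Rightarrow> 'k::{real_normed_field, euclidean_space}. x \<in> Lp M p \<Longrightarrow> z \<in> Lp M p \<Longrightarrow>
      Lp_norm M p (x + z) powr min 2 p + Lp_norm M p (x - z) powr min 2 p
        \<le> 2 * Lp_norm M p x powr min 2 p + C * Lp_norm M p z powr min 2 p"
proof (cases "2 < p")
  case True
  then show ?thesis
    using Lp_uniform_smoothness_gt2[OF True] that by (metis min.absorb1 less_imp_le)
next
  case False
  show ?thesis
  proof (rule that[of 2])
    fix x z :: "'a \<Rightarrow> 'k"
    assume "x \<in> Lp M p" "z \<in> Lp M p"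
    then show "Lp_norm M p (x + z) powr min 2 p + Lp_norm M p (x - z) powr min 2 p
        \<le> 2 * Lp_norm M p x powr min 2 p + 2 * Lp_norm M p z powr min 2 p"
      using Lp_uniform_smoothness_le2[of p x M z] p False by (simp only: min_def) simp
  qed simp
qed

section \<open>Recursive inequalities for sequences\<close>

lemma geometric_recursion_sum_le:
  fixes x D :: "nat \<Rightarrow> real"
  assumes "q \<le> 1" and rec: "\<And>j. n \<le> j \<Longrightarrow> x (Suc j) \<le> q * x j + (D j - D (Suc j))"
    and nonneg: "0 \<le> q" "\<And>j. 0 \<le> x j" "\<And>j. 0 \<le> D j"
  shows "(1 - q) * (\<Sum>k\<in>{n+1..N}. x k) \<le> x n + D n"
proof (cases "n \<le> N")
  case True
  \<comment> \<open>The left side does not increase with \<open>N\<close>: the recursion pays for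
    each new term with the carried amounts \<open>q * x N\<close> and \<open>D N\<close>.\<close>
  then have "(1 - q) * (\<Sum>k\<in>{n+1..N}. x k) + q * x N + D N \<le> q * x n + D n"
  proof (induction N rule: dec_induct)
    case (step N)
    have "(1 - q) * (\<Sum>k\<in>{n+1..Suc N}. x k) + q * x (Suc N) + D (Suc N)
        = (1 - q) * (\<Sum>k\<in>{n+1..N}. x k) + x (Suc N) + D (Suc N)"
      using step.hyps by (simp add: algebra_simps)
    also have "\<dots> \<le> (1 - q) * (\<Sum>k\<in>{n+1..N}. x k) + q * x N + D N"
      using rec[of N] step.hyps by simp
    finally show ?case
      using step.IH by linarith
  qed simp
  moreover have "0 \<le> q * x N" "0 \<le> D N" "q * x n \<le> x n"
    using nonneg \<open>q \<le> 1\<close> mult_right_mono[of q 1 "x n"] by auto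
  ultimately show ?thesis
    by linarith
qed (use nonneg in simp)

text \<open>The partial sum has a closed form that stays below \<open>q\<close>. The bound fixes the
  size of the look-ahead weights.\<close>

lemma sum_index_power_le:
  fixes q :: real
  assumes "0 \<le> q" "q \<le> 1"
  shows "(1 - q)\<^sup>2 * (\<Sum>i\<in>{1..N}. real i * q ^ i) \<le> 1"
proof -
  have "(1 - q)\<^sup>2 * (\<Sum>i\<in>{1..N}. real i * q ^ i) = q - real (N + 1) * q ^ (N + 1) + real N * q ^ (N + 2)"
    by (induction N) (simp_all add: distrib_left power2_eq_square algebra_simps)
  also have "\<dots> \<le> q"
  proof -
    have "real N * q ^ (N + 2) \<le> real (N + 1) * q ^ (N + 1)"
      using assms by (intro mult_mono power_decreasing) auto
    then show ?thesis by linarith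
  qed
  finally show ?thesis
    using assms by linarith
qed

text \<open>A shift by \<open>i\<close> consists of \<open>i\<close> unit shifts, and each of them
  telescopes over \<open>m\<close> to at most \<open>D n\<close>.\<close>

lemma sum_shift_difference_le:
  fixes D :: "nat \<Rightarrow> real"
  assumes "decseq D" "\<And>j. 0 \<le> D j"
  shows "(\<Sum>m\<in>{n+1..L}. D m - D (m + i)) \<le> real i * D n"
proof (induction i)
  case (Suc i)
  have "(\<Sum>m\<in>{n+1..L}. D (m + i) - D (m + Suc i)) \<le> D n"
  proof (cases "n + 1 \<le> L")
    case True
    have "(\<Sum>m\<in>{n+1..L}. D (m + i) - D (m + Suc i)) = D (n + 1 + i) - D (L + 1 + i)"
      using True sum_Suc_diff[of "n + 1" L "\<lambda>m. - D (m + i)"] by simp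
    also have "\<dots> \<le> D n"
      using decseqD[OF assms(1), of n "n + 1 + i"] assms(2)[of "L + 1 + i"] by simp
    finally show ?thesis .
  qed (use assms in simp)
  moreover have "(\<Sum>m\<in>{n+1..L}. D m - D (m + Suc i))
      = (\<Sum>m\<in>{n+1..L}. D m - D (m + i)) + (\<Sum>m\<in>{n+1..L}. D (m + i) - D (m + Suc i))"
    by (simp flip: sum.distrib)
  ultimately show ?case
    using Suc.IH by (simp add: distrib_right)
qed simp

text \<open>The weights \<open>w i\<close> are small enough that the look-ahead terms, whose sum over \<open>m\<close>
  telescopes to at most \<open>i * D n\<close>, absorb only half of the left-hand side.\<close>

lemma look_ahead_recursion:
  fixes D R w :: "nat \<Rightarrow> real"
  assumes dec: "decseq D" and nonneg: "\<And>j. 0 \<le> D j" "\<And>i. 0 \<le> w i"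
    and w: "(\<Sum>i\<in>{1..L+1}. real i * w i) \<le> 1 / 2" and "n \<le> L"
    and rec: "\<And>m. n < m \<Longrightarrow> m \<le> L \<Longrightarrow>
      D (m - 1) \<le> D m + (\<Sum>i\<in>{1..L-m+1}. w i * (D m - (if m + i \<le> L then D (m + i) else 0))) + R m"
  shows "D n \<le> 2 * (D L + (\<Sum>m\<in>{n+1..L}. R m))"
proof -
  \<comment> \<open>Setting the sequence to zero beyond \<open>L\<close> keeps it decreasing, so all
    look-ahead sums extend to the common range \<open>{1..L+1}\<close> by nonnegative terms and can
    be interchanged with the sum over \<open>m\<close>.\<close>
  define D' where "D' = (\<lambda>j. if j \<le> L then D j else 0)"
  have D': "decseq D'" "\<And>j. 0 \<le> D' j"
    using dec nonneg by (auto simp: D'_def decseq_def)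
  have "D n - D L = (\<Sum>m\<in>{n+1..L}. D (m - 1) - D m)"
    using \<open>n \<le> L\<close>
  proof (induction L rule: dec_induct)
    case (step L)
    then show ?case by simp
  qed simp
  also have "\<dots> \<le> (\<Sum>m\<in>{n+1..L}. (\<Sum>i\<in>{1..L+1}. w i * (D' m - D' (m + i))) + R m)"
  proof (rule sum_mono)
    fix m assume m: "m \<in> {n+1..L}"
    have "D (m - 1) - D m \<le> (\<Sum>i\<in>{1..L-m+1}. w i * (D' m - D' (m + i))) + R m"
      using rec[of m] m by (simp add: D'_def)
    also have "(\<Sum>i\<in>{1..L-m+1}. w i * (D' m - D' (m + i))) \<le> (\<Sum>i\<in>{1..L+1}. w i * (D' m - D' (m + i)))"
      using nonneg D' by (intro sum_mono2) (auto simp: decseq_def)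
    finally show "D (m - 1) - D m \<le> (\<Sum>i\<in>{1..L+1}. w i * (D' m - D' (m + i))) + R m"
      by simp
  qed
  also have "\<dots> = (\<Sum>i\<in>{1..L+1}. w i * (\<Sum>m\<in>{n+1..L}. D' m - D' (m + i))) + (\<Sum>m\<in>{n+1..L}. R m)"
    unfolding sum.distrib by (subst sum.swap) (simp add: sum_distrib_left)
  also have "(\<Sum>i\<in>{1..L+1}. w i * (\<Sum>m\<in>{n+1..L}. D' m - D' (m + i))) \<le> (\<Sum>i\<in>{1..L+1}. w i * (real i * D' n))"
    using nonneg by (intro sum_mono mult_left_mono sum_shift_difference_le D')
  also have "\<dots> = (\<Sum>i\<in>{1..L+1}. real i * w i) * D n"
    using \<open>n \<le> L\<close> by (simp add: D'_def sum_distrib_left sum_distrib_right mult_ac del: sum.cl_ivl_Suc)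
  also have "\<dots> \<le> 1 / 2 * D n"
    using w nonneg by (intro mult_right_mono)
  finally show ?thesis
    by simp
qed

section \<open>Best approximation from convex sets\<close>

lemma power_powr_swap:
  fixes \<alpha> :: real
  shows "(2 powr \<alpha>) ^ k = real (2 ^ k) powr \<alpha>" "(2 powr \<alpha>) ^ k = 2 powr (real k * \<alpha>)"
  by (simp_all add: powr_power powr_powr powr_powr_swap mult.commute flip: powr_realpow)

text \<open>The constants of the Jackson, Bernstein and realization inequalities are fixed here, so
  constants obtained inside are uniform in \<open>f\<close> and \<open>n\<close>.\<close>

locale convex_approximation =
  fixes M :: "'a measure"
    and p \<alpha> c1 c2 c3 :: real
    and Y :: "('a \<Rightarrow> 'k::{real_normed_field, euclidean_space}) set"
    and normY :: "('a \<Rightarrow> 'k) \<Rightarrow> real"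
    and G :: "nat \<Rightarrow> ('a \<Rightarrow> 'k) set"
    and P :: "nat \<Rightarrow> ('a \<Rightarrow> 'k) \<Rightarrow> ('a \<Rightarrow> 'k)"
  assumes p: "1 < p"
    and \<alpha>: "0 < \<alpha>"
    and Y_Lp: "Y \<subseteq> Lp M p" and Y_subspace: "linear_subspace Y"
    and normY: "seminorm_on Y normY"
    and G_sub: "\<And>n. n \<ge> 1 \<Longrightarrow> G n \<subseteq> Y"
    and G_zero: "0 \<in> G 1"
    and G_mono: "\<And>n. n \<ge> 1 \<Longrightarrow> G n \<subseteq> G (n + 1)"
    and G_sym: "\<And>n. n \<ge> 1 \<Longrightarrow> G n = uminus ` G n"
    and G_dense: "\<And>f \<epsilon>. f \<in> Lp M p \<Longrightarrow> 0 < \<epsilon> \<Longrightarrow> \<exists>n\<ge>1. \<exists>g\<in>G n. Lp_norm M p (f - g) < \<epsilon>"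
    and G_convex: "\<And>n. n \<ge> 1 \<Longrightarrow> convex_fun_set (G n)"
    and P_best: "\<And>n f. n \<ge> 1 \<Longrightarrow> f \<in> Lp M p \<Longrightarrow>
          P n f \<in> G n \<and> Lp_norm M p (f - P n f) = approx_error M p (G n) f"
    and c_pos: "0 < c1" "0 < c2" "0 < c3"
    and Jackson: "\<And>f n. f \<in> Y \<Longrightarrow> n \<ge> 1 \<Longrightarrow>
          approx_error M p (G n) f \<le> c1 * real n powr (- \<alpha>) * normY f"
    and Bernstein: "\<And>n g\<^sub>1 g\<^sub>2. n \<ge> 1 \<Longrightarrow> g\<^sub>1 \<in> G n \<Longrightarrow> g\<^sub>2 \<in> G n \<Longrightarrow>
          normY (g\<^sub>1 - g\<^sub>2) \<le> c2 * real n powr \<alpha> * Lp_norm M p (g\<^sub>1 - g\<^sub>2)"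
    and realization: "\<And>f n. f \<in> Lp M p \<Longrightarrow> n \<ge> 1 \<Longrightarrow>
          (INF g\<in>G n. Lp_norm M p (f - g) + real n powr (- \<alpha>) * normY g)
            \<le> c3 * K_functional M p Y normY f (real n powr (- \<alpha>))"
begin

section \<open>Notation at dyadic levels and elementary properties\<close>

abbreviation "\<nu> \<equiv> Lp_norm M p"

abbreviation "Q k f \<equiv> P (2 ^ k) f"

abbreviation "E k f \<equiv> \<nu> (f - Q k f)"

definition "q = 2 powr (- \<alpha>)"

abbreviation "\<eta> k f \<equiv> q ^ k * normY (Q k f)"

lemma p1: "1 \<le> p" "0 < p"
  using p by auto

lemma q: "0 < q" "q < 1"
  using \<alpha> by (auto simp: q_def powr_less_one)

lemma q_power: "real (2 ^ k) powr (- \<alpha>) = q ^ k" "real (2 ^ k) powr \<alpha> = 1 / q ^ k"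
  "2 powr (- real k * \<alpha>) = q ^ k"
  using power_powr_swap[of "- \<alpha>" k] by (auto simp: q_def powr_minus_divide)

lemma G_mono_le:
  assumes "1 \<le> m" "m \<le> n"
  shows "G m \<subseteq> G n"
  using assms(2)
proof (induction rule: dec_induct)
  case (step n)
  then show ?case
    using G_mono[of n] assms(1) by auto
qed simp

lemma G_pow_mono: "k \<le> l \<Longrightarrow> G (2 ^ k) \<subseteq> G (2 ^ l)"
  by (intro G_mono_le) (auto intro: power_increasing)

lemma zero_in_G: "1 \<le> n \<Longrightarrow> 0 \<in> G n"
  using G_zero G_mono_le[of 1 n] by auto

lemma G_Y: "g \<in> G (2 ^ k) \<Longrightarrow> g \<in> Y"
  using G_sub[of "2 ^ k"] by auto

lemma Y_Lp': "g \<in> Y \<Longrightarrow> g \<in> Lp M p"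
  using Y_Lp by auto

lemma G_Lp: "g \<in> G (2 ^ k) \<Longrightarrow> g \<in> Lp M p"
  using G_Y Y_Lp' by blast

lemma G_convexD:
  assumes "f \<in> G (2 ^ k)" "g \<in> G (2 ^ k)" "0 \<le> u" "0 \<le> v" "u + v = 1"
  shows "(\<lambda>x. u *\<^sub>R f x + v *\<^sub>R g x) \<in> G (2 ^ k)"
  using G_convex[of "2 ^ k"] assms by (auto simp: convex_fun_set_def)

lemma G_uminus: "g \<in> G (2 ^ k) \<Longrightarrow> - g \<in> G (2 ^ k)"
  using G_sym[of "2 ^ k"] by force

lemma Q_G:
  assumes "f \<in> Lp M p"
  shows "Q k f \<in> G (2 ^ k)" "Q k f \<in> Y" "Q k f \<in> Lp M p"
  using P_best[of "2 ^ k" f] assms G_Y G_Lp by auto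

lemma E_eq: "f \<in> Lp M p \<Longrightarrow> E k f = approx_error M p (G (2 ^ k)) f"
  using P_best[of "2 ^ k" f] by auto

lemma E_le:
  assumes "f \<in> Lp M p" "g \<in> G (2 ^ k)"
  shows "E k f \<le> \<nu> (f - g)"
proof -
  have "(INF g\<in>G (2 ^ k). \<nu> (f - g)) \<le> \<nu> (f - g)"
    by (rule cINF_lower[OF _ assms(2)]) (auto intro!: bdd_belowI2[of _ 0])
  then show ?thesis
    using E_eq[OF assms(1)] by (simp add: approx_error_def)
qed

lemma E_decreasing:
  assumes "f \<in> Lp M p" "k \<le> l"
  shows "E l f \<le> E k f"
  using assms Q_G(1)[OF assms(1), of k] G_pow_mono[of k l] by (intro E_le) auto

lemma E_tendsto:
  assumes f: "f \<in> Lp M p"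
  shows "(\<lambda>k. E k f) \<longlonglongrightarrow> 0"
proof (rule LIMSEQ_I)
  fix r :: real assume "0 < r"
  then obtain n g where n: "1 \<le> n" "g \<in> G n" "\<nu> (f - g) < r"
    using G_dense[OF f] by blast
  have "norm (E k f - 0) < r" if "n \<le> k" for k
  proof -
    have "n \<le> 2 ^ k"
      using that less_exp[of k] by linarith
    then have "g \<in> G (2 ^ k)"
      using G_mono_le[of n "2 ^ k"] n by auto
    then show ?thesis
      using E_le[OF f] n(3) by fastforce
  qed
  then show "\<exists>no. \<forall>k\<ge>no. norm (E k f - 0) < r"
    by blast
qed

lemma normY_nonneg: "f \<in> Y \<Longrightarrow> 0 \<le> normY f"
  using normY by (simp add: seminorm_on_def)

lemma normY_add: "f \<in> Y \<Longrightarrow> g \<in> Y \<Longrightarrow> normY (f + g) \<le> normY f + normY g"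
  using normY by (simp add: seminorm_on_def)

lemma Y_scaleR: "f \<in> Y \<Longrightarrow> (\<lambda>x. r *\<^sub>R f x) \<in> Y"
  using Y_subspace by (auto simp: linear_subspace_def scaleR_conv_of_real)

lemma normY_scaleR: "f \<in> Y \<Longrightarrow> normY (\<lambda>x. r *\<^sub>R f x) = \<bar>r\<bar> * normY f"
  using normY by (simp add: seminorm_on_def scaleR_conv_of_real)

lemma Y_diff:
  assumes "f \<in> Y" "g \<in> Y"
  shows "f - g \<in> Y"
proof -
  have "f + (\<lambda>x. (-1) *\<^sub>R g x) \<in> Y"
    using Y_subspace assms Y_scaleR[OF assms(2), of "-1"] unfolding linear_subspace_def by blast
  moreover have "f + (\<lambda>x. (-1) *\<^sub>R g x) = f - g"
    by (auto simp: fun_eq_iff)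
  ultimately show ?thesis by simp
qed

lemma normY_triangle:
  assumes "f \<in> Y" "g \<in> Y"
  shows "normY f \<le> normY g + normY (f - g)"
  using normY_add[OF assms(2) Y_diff[OF assms]] by simp

lemma \<eta>_nonneg: "f \<in> Lp M p \<Longrightarrow> 0 \<le> \<eta> k f"
  using q normY_nonneg Q_G by simp

section \<open>Bounds through the K-functional\<close>

lemma K_le:
  assumes "0 \<le> t" "g \<in> Y"
  shows "K_functional M p Y normY f t \<le> \<nu> (f - g) + t * normY g"
  unfolding K_functional_def
  by (rule cINF_lower[OF _ assms(2)]) (use assms normY_nonneg in \<open>auto intro!: bdd_belowI2[of _ 0]\<close>)

lemma K_nonneg:
  assumes "0 \<le> t"
  shows "0 \<le> K_functional M p Y normY f t"
  unfolding K_functional_def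
  using Y_subspace assms normY_nonneg by (intro cINF_greatest) (auto simp: linear_subspace_def)

text \<open>The infimum in the realization inequality need not be attained, so an estimate is proved
  for every \<open>g\<close> of the set and then passed to the infimum.\<close>

lemma le_realization:
  assumes f: "f \<in> Lp M p" and "0 \<le> a"
    and b: "\<And>g. g \<in> G (2 ^ n) \<Longrightarrow> b \<le> a * (\<nu> (f - g) + q ^ n * normY g)"
  shows "b \<le> a * c3 * K_functional M p Y normY f (q ^ n)"
proof (cases "a = 0")
  case True
  then show ?thesis
    using b[OF zero_in_G[of "2 ^ n"]] by simp
next
  case False
  with \<open>0 \<le> a\<close> have a: "0 < a" by simp
  have "b / a \<le> (INF g\<in>G (2 ^ n). \<nu> (f - g) + q ^ n * normY g)"
    using b zero_in_G[of "2 ^ n"] a by (intro cINF_greatest) (auto simp: divide_le_eq mult.commute)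
  also have "\<dots> \<le> c3 * K_functional M p Y normY f (q ^ n)"
    using realization[OF f, of "2 ^ n"] by (simp only: q_power) simp
  finally show ?thesis
    using a by (simp add: divide_le_eq mult_ac)
qed

lemma Bernstein_dyadic:
  assumes "g \<in> G (2 ^ k)" "h \<in> G (2 ^ k)"
  shows "q ^ k * normY (g - h) \<le> c2 * \<nu> (g - h)"
  using Bernstein[of "2 ^ k", OF _ assms] q unfolding q_power by (simp add: field_simps)

lemma E_le_K:
  assumes f: "f \<in> Lp M p"
  shows "E n f \<le> c3 * K_functional M p Y normY f (q ^ n)"
  using le_realization[OF f, of 1 n "E n f"] E_le[OF f] q normY_nonneg G_Y
  by (smt (verit, best) mult_1 mult_nonneg_nonneg zero_le_power)

text \<open>Bernstein's inequality applies to \<open>Q n f - g\<close>, since both elements lie in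
  \<open>G (2 ^ n)\<close>; best approximation bounds the norm of this difference by twice that of
  \<open>f - g\<close>.\<close>

lemma \<eta>_le_K:
  assumes f: "f \<in> Lp M p"
  shows "\<eta> n f \<le> (1 + 2 * c2) * c3 * K_functional M p Y normY f (q ^ n)"
proof (rule le_realization[OF f])
  fix g assume g: "g \<in> G (2 ^ n)"
  note mem = Q_G[OF f, of n] G_Y[OF g] G_Lp[OF g]
  have "\<nu> (Q n f - g) \<le> E n f + \<nu> (f - g)"
    using Lp_norm_diff_triangle[OF p1(1) mem(3) f mem(5)] by (simp only: Lp_norm_minus_commute)
  then have "\<nu> (Q n f - g) \<le> 2 * \<nu> (f - g)"
    using E_le[OF f g] by linarith
  then have s: "c2 * \<nu> (Q n f - g) \<le> c2 * (2 * \<nu> (f - g))"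
    using c_pos by (intro mult_left_mono) auto
  have "\<eta> n f \<le> q ^ n * (normY g + normY (Q n f - g))"
    using normY_triangle[OF mem(2,4)] q by (intro mult_left_mono) auto
  also have "\<dots> \<le> q ^ n * normY g + c2 * (2 * \<nu> (f - g))"
    using Bernstein_dyadic[OF mem(1) g] s by (simp add: distrib_left)
  also have "\<dots> \<le> (1 + 2 * c2) * (\<nu> (f - g) + q ^ n * normY g)"
    using c_pos q normY_nonneg[OF mem(4)] by (simp add: algebra_simps add_nonneg_nonneg)
  finally show "\<eta> n f \<le> (1 + 2 * c2) * (\<nu> (f - g) + q ^ n * normY g)" .
qed (use c_pos in simp)

section \<open>First inequality: increments of best approximations\<close>

lemma best_approximation_increment:
  obtains C where "0 < C"
    "\<And>f j. f \<in> Lp M p \<Longrightarrow> \<nu> (Q (Suc j) f - Q j f) powr max 2 p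
       \<le> C * (E j f powr max 2 p - E (Suc j) f powr max 2 p)"
proof -
  obtain C where C: "0 < C"
    "\<And>u v :: 'a \<Rightarrow> 'k. u \<in> Lp M p \<Longrightarrow> v \<in> Lp M p \<Longrightarrow>
       \<nu> u \<le> \<nu> v \<Longrightarrow> \<nu> u \<le> \<nu> (\<lambda>x. (1/2) *\<^sub>R (u x + v x)) \<Longrightarrow>
       \<nu> (u - v) powr max 2 p \<le> C * (\<nu> v powr max 2 p - \<nu> u powr max 2 p)"
    using Lp_uniform_convexity[OF p, of M] by blast
  have "\<nu> (Q (Suc j) f - Q j f) powr max 2 p \<le> C * (E j f powr max 2 p - E (Suc j) f powr max 2 p)"
    if f: "f \<in> Lp M p" for f j
  proof -
    \<comment> \<open>The midpoint of the two approximations is a competitor at level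
      \<open>Suc j\<close>. This is the midpoint condition of uniform convexity for the two error
      functions.\<close>
    let ?h = "\<lambda>x. (1/2) *\<^sub>R Q (Suc j) f x + (1/2) *\<^sub>R Q j f x"
    have "Q j f \<in> G (2 ^ Suc j)"
      using Q_G(1)[OF f, of j] G_pow_mono[of j "Suc j"] by auto
    then have "?h \<in> G (2 ^ Suc j)"
      by (intro G_convexD Q_G f) auto
    then have "E (Suc j) f \<le> \<nu> (f - ?h)"
      by (rule E_le[OF f])
    also have "f - ?h = (\<lambda>x. (1/2) *\<^sub>R ((f - Q (Suc j) f) x + (f - Q j f) x))"
    proof
      fix x
      have "f x = (1/2) *\<^sub>R f x + (1/2) *\<^sub>R f x"
        by (simp flip: scaleR_left_distrib)
      then have "(f - ?h) x = ((1/2) *\<^sub>R f x + (1/2) *\<^sub>R f x) - ?h x"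
        by simp
      also have "\<dots> = (1/2) *\<^sub>R ((f - Q (Suc j) f) x + (f - Q j f) x)"
        by (simp only: minus_apply scaleR_right_distrib scaleR_right_diff_distrib) (simp add: algebra_simps)
      finally show "(f - ?h) x = (1/2) *\<^sub>R ((f - Q (Suc j) f) x + (f - Q j f) x)" .
    qed
    finally have mid: "E (Suc j) f \<le> \<nu> (\<lambda>x. (1/2) *\<^sub>R ((f - Q (Suc j) f) x + (f - Q j f) x))" .
    have "E (Suc j) f \<le> E j f"
      by (rule E_decreasing[OF f]) simp
    then have "\<nu> ((f - Q (Suc j) f) - (f - Q j f)) powr max 2 p
        \<le> C * (E j f powr max 2 p - E (Suc j) f powr max 2 p)"
      by (rule C(2)[OF Lp_diff[OF p1(1) f Q_G(3)[OF f]] Lp_diff[OF p1(1) f Q_G(3)[OF f]] _ mid])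
    then show ?thesis
      using Lp_norm_minus_commute[of M p "Q j f" "Q (Suc j) f"] by simp
  qed
  then show ?thesis
    using that C(1) by blast
qed

lemma \<eta>_Suc_le:
  assumes f: "f \<in> Lp M p"
  shows "\<eta> (Suc j) f \<le> q * \<eta> j f + c2 * \<nu> (Q (Suc j) f - Q j f)"
proof -
  have G: "Q (Suc j) f \<in> G (2 ^ Suc j)" "Q j f \<in> G (2 ^ Suc j)"
    using Q_G(1)[OF f, of "Suc j"] Q_G(1)[OF f, of j] G_pow_mono[of j "Suc j"] by auto
  have "\<eta> (Suc j) f \<le> q ^ Suc j * (normY (Q j f) + normY (Q (Suc j) f - Q j f))"
    using normY_triangle[OF Q_G(2)[OF f] Q_G(2)[OF f], of "Suc j" j] q by (intro mult_left_mono) auto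
  also have "\<dots> \<le> q * \<eta> j f + c2 * \<nu> (Q (Suc j) f - Q j f)"
    using Bernstein_dyadic[OF G] by (simp add: distrib_left)
  finally show ?thesis .
qed

lemma sum_\<eta>_powr_le:
  obtains C where "0 < C"
    "\<And>f n N. f \<in> Lp M p \<Longrightarrow> (\<Sum>k\<in>{n+1..N}. \<eta> k f powr max 2 p)
       \<le> (C * K_functional M p Y normY f (q ^ n)) powr max 2 p"
proof -
  define \<tau> where "\<tau> = max 2 p"
  have \<tau>: "1 \<le> \<tau>" "0 < \<tau>" by (auto simp: \<tau>_def)
  obtain C1 where C1: "0 < C1"
    "\<And>f j. f \<in> Lp M p \<Longrightarrow> \<nu> (Q (Suc j) f - Q j f) powr \<tau> \<le> C1 * (E j f powr \<tau> - E (Suc j) f powr \<tau>)"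
    using best_approximation_increment unfolding \<tau>_def by blast
  \<comment> \<open>The factor that convexity puts on the increments, times the constant
    \<open>C1\<close> that makes them telescope.\<close>
  define B where "B = (1 - q) * (c2 / (1 - q)) powr \<tau> * C1"
  define A where "A = (((1 + 2 * c2) * c3) powr \<tau> + B * c3 powr \<tau>) / (1 - q)"
  have B: "0 < B"
    using q c_pos C1(1) by (simp add: B_def)
  have A: "0 < A"
    using q c_pos B by (simp add: A_def add_pos_pos)
  have "(\<Sum>k\<in>{n+1..N}. \<eta> k f powr \<tau>) \<le> (A powr (1 / \<tau>) * K_functional M p Y normY f (q ^ n)) powr \<tau>"
    if f: "f \<in> Lp M p" for f n N
  proof -
    define K where "K = K_functional M p Y normY f (q ^ n)"
    have K: "0 \<le> K"
      unfolding K_def using q by (intro K_nonneg) auto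
    have rec: "\<eta> (Suc j) f powr \<tau> \<le> q * \<eta> j f powr \<tau> + (B * E j f powr \<tau> - B * E (Suc j) f powr \<tau>)" for j
    proof -
      define d where "d = \<nu> (Q (Suc j) f - Q j f)"
      have d: "0 \<le> d" by (simp add: d_def)
      have "\<eta> (Suc j) f powr \<tau> \<le> (q * \<eta> j f + c2 * d) powr \<tau>"
        using \<eta>_Suc_le[OF f, of j] \<eta>_nonneg[OF f, of "Suc j"] \<tau> unfolding d_def by (intro powr_mono2) auto
      \<comment> \<open>As a convex combination with weights \<open>q\<close> and
        \<open>1 - q\<close>, the sum keeps the contraction factor \<open>q\<close> in front of the
        first term after the power is taken.\<close>
      also have "q * \<eta> j f + c2 * d = q *\<^sub>R \<eta> j f + (1 - q) *\<^sub>R (c2 / (1 - q) * d)"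
        using q by simp
      also have "\<dots> powr \<tau> \<le> q * \<eta> j f powr \<tau> + (1 - q) * (c2 / (1 - q) * d) powr \<tau>"
        using convex_onD[OF convex_on_powr_nonneg[OF \<tau>(1)], of "1 - q" "\<eta> j f" "c2 / (1 - q) * d"]
          q c_pos d \<eta>_nonneg[OF f, of j] by simp
      also have "\<dots> = q * \<eta> j f powr \<tau> + (1 - q) * (c2 / (1 - q)) powr \<tau> * d powr \<tau>"
        by (simp only: powr_mult mult.assoc)
      also have "\<dots> \<le> q * \<eta> j f powr \<tau> + (1 - q) * (c2 / (1 - q)) powr \<tau> * (C1 * (E j f powr \<tau> - E (Suc j) f powr \<tau>))"
        using C1(2)[OF f, of j] q unfolding d_def by (intro add_left_mono mult_left_mono) auto
      also have "\<dots> = q * \<eta> j f powr \<tau> + (B * E j f powr \<tau> - B * E (Suc j) f powr \<tau>)"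
        by (simp add: B_def right_diff_distrib mult.assoc)
      finally show ?thesis .
    qed
    have "(1 - q) * (\<Sum>k\<in>{n+1..N}. \<eta> k f powr \<tau>) \<le> \<eta> n f powr \<tau> + B * E n f powr \<tau>"
      using q B by (intro geometric_recursion_sum_le rec) auto
    also have "\<dots> \<le> ((1 + 2 * c2) * c3 * K) powr \<tau> + B * (c3 * K) powr \<tau>"
      using \<eta>_le_K[OF f, of n] E_le_K[OF f, of n] \<eta>_nonneg[OF f, of n] \<tau> B unfolding K_def
      by (intro add_mono mult_left_mono powr_mono2) auto
    also have "\<dots> = (1 - q) * A * K powr \<tau>"
    proof -
      have "(1 - q) * A = ((1 + 2 * c2) * c3) powr \<tau> + B * c3 powr \<tau>"
        using q by (simp add: A_def)
      then show ?thesis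
        by (simp only: powr_mult[of "(1 + 2 * c2) * c3" K] powr_mult[of c3 K] mult.assoc[of B]
            distrib_right[of "((1 + 2 * c2) * c3) powr \<tau>"])
    qed
    finally have "(\<Sum>k\<in>{n+1..N}. \<eta> k f powr \<tau>) \<le> A * K powr \<tau>"
      using q by (simp add: mult.assoc)
    also have "\<dots> = (A powr (1 / \<tau>) * K) powr \<tau>"
      using A \<tau> by (simp add: powr_mult powr_powr)
    finally show ?thesis
      unfolding K_def .
  qed
  then show ?thesis
    using that[of "A powr (1 / \<tau>)"] A unfolding \<tau>_def by auto
qed

text \<open>The uniform bound on partial sums gives both summability and the estimate. Summability
  is recorded because \<open>infsum\<close> has the value 0 on families that are not
  summable.\<close>

lemma upper_estimate:
  obtains C where "0 < C"
    "\<And>f n. f \<in> Lp M p \<Longrightarrow> (\<lambda>k. \<eta> k f powr max 2 p) summable_on {n+1..}"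
    "\<And>f n. f \<in> Lp M p \<Longrightarrow> (\<Sum>\<^sub>\<infinity>k\<in>{n+1..}. \<eta> k f powr max 2 p) powr (1 / max 2 p)
       \<le> C * K_functional M p Y normY f (q ^ n)"
proof -
  define \<tau> where "\<tau> = max 2 p"
  have \<tau>: "0 < \<tau>" by (auto simp: \<tau>_def)
  obtain C where C: "0 < C"
    "\<And>f n N. f \<in> Lp M p \<Longrightarrow> (\<Sum>k\<in>{n+1..N}. \<eta> k f powr \<tau>)
       \<le> (C * K_functional M p Y normY f (q ^ n)) powr \<tau>"
    using sum_\<eta>_powr_le unfolding \<tau>_def by blast
  have finite_bound: "(\<Sum>k\<in>F. \<eta> k f powr \<tau>) \<le> (C * K_functional M p Y normY f (q ^ n)) powr \<tau>"
    if f: "f \<in> Lp M p" and F: "finite F" "F \<subseteq> {n+1..}" for f n F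
  proof -
    have "F \<subseteq> {n+1..Max F}"
      using F by (auto dest: Max_ge)
    then have "(\<Sum>k\<in>F. \<eta> k f powr \<tau>) \<le> (\<Sum>k\<in>{n+1..Max F}. \<eta> k f powr \<tau>)"
      by (intro sum_mono2) auto
    with C(2)[OF f, of n "Max F"] show ?thesis
      by linarith
  qed
  have sm: "(\<lambda>k. \<eta> k f powr \<tau>) summable_on {n+1..}" if f: "f \<in> Lp M p" for f n
    using finite_bound[OF f] by (intro nonneg_bdd_above_summable_on) (auto intro!: bdd_aboveI2)
  have "(\<Sum>\<^sub>\<infinity>k\<in>{n+1..}. \<eta> k f powr \<tau>) powr (1 / \<tau>) \<le> C * K_functional M p Y normY f (q ^ n)"
    if f: "f \<in> Lp M p" for f n
  proof -
    have K: "0 \<le> C * K_functional M p Y normY f (q ^ n)"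
      using C(1) q by (intro mult_nonneg_nonneg K_nonneg) auto
    have "(\<Sum>\<^sub>\<infinity>k\<in>{n+1..}. \<eta> k f powr \<tau>) \<le> (C * K_functional M p Y normY f (q ^ n)) powr \<tau>"
      using finite_bound[OF f] by (intro infsum_le_finite_sums sm f) auto
    then have "(\<Sum>\<^sub>\<infinity>k\<in>{n+1..}. \<eta> k f powr \<tau>) powr (1 / \<tau>)
        \<le> ((C * K_functional M p Y normY f (q ^ n)) powr \<tau>) powr (1 / \<tau>)"
      using \<tau> by (intro powr_mono2 infsum_nonneg) auto
    also have "\<dots> = C * K_functional M p Y normY f (q ^ n)"
      using K \<tau> by (simp add: powr_powr)
    finally show ?thesis .
  qed
  with C(1) sm show ?thesis
    using that unfolding \<tau>_def by blast
qed

section \<open>Second inequality: errors controlled by look-ahead\<close>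

text \<open>The Jackson inequality is homogeneous in \<open>h\<close> although \<open>G n\<close> is not a cone: applied to
  \<open>r h\<close>, it approximates \<open>h\<close> by elements of the shrunken set \<open>G n / r\<close>.\<close>

lemma Jackson_scaled:
  assumes h: "h \<in> Y" and "0 < r"
  obtains a where "(\<lambda>x. r *\<^sub>R a x) \<in> G (2 ^ j)" "a \<in> Y" "\<nu> (h - a) \<le> c1 * q ^ j * normY h"
proof
  define g where "g = Q j (\<lambda>x. r *\<^sub>R h x)"
  let ?a = "\<lambda>x. (1 / r) *\<^sub>R g x"
  have rh: "(\<lambda>x. r *\<^sub>R h x) \<in> Y"
    by (rule Y_scaleR[OF h])
  have g: "g \<in> G (2 ^ j)" "g \<in> Y"
    unfolding g_def by (intro Q_G Y_Lp' rh)+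
  show "(\<lambda>x. r *\<^sub>R ?a x) \<in> G (2 ^ j)"
    using g \<open>0 < r\<close> by simp
  show "?a \<in> Y"
    by (rule Y_scaleR[OF g(2)])
  have "h - ?a = (\<lambda>x. (1 / r) *\<^sub>R ((\<lambda>x. r *\<^sub>R h x) - g) x)"
    using \<open>0 < r\<close> by (auto simp: fun_eq_iff scaleR_right_diff_distrib)
  then have "\<nu> (h - ?a) = 1 / r * \<nu> ((\<lambda>x. r *\<^sub>R h x) - g)"
    using Lp_norm_scaleR[OF p1(2), of M "1 / r" "(\<lambda>x. r *\<^sub>R h x) - g"] \<open>0 < r\<close> by simp
  also have "\<dots> \<le> 1 / r * (c1 * real (2 ^ j) powr (- \<alpha>) * normY (\<lambda>x. r *\<^sub>R h x))"
    unfolding g_def E_eq[OF Y_Lp'[OF rh], of j]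
    using Jackson[OF rh, of "2 ^ j"] \<open>0 < r\<close> by (intro mult_left_mono) auto
  also have "\<dots> = c1 * q ^ j * normY h"
    using \<open>0 < r\<close> by (simp only: q_power normY_scaleR[OF h]) simp
  finally show "\<nu> (h - ?a) \<le> c1 * q ^ j * normY h" .
qed

text \<open>With \<open>\<mu> = 2 * t / r\<close>, the element \<open>(1 - \<mu>) h + t (b - a)\<close> is the convex combination of \<open>h\<close> and
  \<open>(r b - r a) / 2\<close>. For large \<open>r\<close> the direction \<open>b - a\<close> is thus almost one of recession of \<open>G (2 ^ j)\<close>.\<close>

lemma perturbation_lower_bound:
  assumes f: "f \<in> Lp M p" and h: "h \<in> G (2 ^ j)" and "0 < r" "0 \<le> t" "2 * t \<le> r"
    and a: "(\<lambda>x. r *\<^sub>R a x) \<in> G (2 ^ j)" "a \<in> Y" and b: "(\<lambda>x. r *\<^sub>R b x) \<in> G (2 ^ j)" "b \<in> Y"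
  shows "E j f \<le> \<nu> (f - h - (\<lambda>x. t *\<^sub>R (b - a) x)) + 2 * t / r * \<nu> h"
proof -
  define \<mu> where "\<mu> = 2 * t / r"
  have \<mu>: "0 \<le> \<mu>" "\<mu> \<le> 1" "\<mu> * (1/2) * r = t"
    using assms by (auto simp: \<mu>_def)
  let ?d = "\<lambda>x. (1/2) *\<^sub>R (r *\<^sub>R b x) + (1/2) *\<^sub>R (- (\<lambda>x. r *\<^sub>R a x)) x"
  let ?g = "\<lambda>x. (1 - \<mu>) *\<^sub>R h x + \<mu> *\<^sub>R ?d x"
  have d: "?d \<in> G (2 ^ j)"
    by (rule G_convexD[OF b(1) G_uminus[OF a(1)]]) auto
  have "?g \<in> G (2 ^ j)"
    by (rule G_convexD[OF h d]) (use \<mu> in auto)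
  then have "E j f \<le> \<nu> (f - ?g)"
    by (rule E_le[OF f])
  also have "f - ?g = (f - h - (\<lambda>x. t *\<^sub>R (b - a) x)) + (\<lambda>x. \<mu> *\<^sub>R h x)"
  proof
    fix x
    have "\<mu> *\<^sub>R ?d x = (\<mu> * (1/2) * r) *\<^sub>R (b x - a x)"
      by (simp add: scaleR_right_diff_distrib)
    then show "(f - ?g) x = ((f - h - (\<lambda>x. t *\<^sub>R (b - a) x)) + (\<lambda>x. \<mu> *\<^sub>R h x)) x"
      unfolding \<mu>(3) by (simp add: scaleR_left_diff_distrib)
  qed
  also have "\<nu> \<dots> \<le> \<nu> (f - h - (\<lambda>x. t *\<^sub>R (b - a) x)) + \<nu> (\<lambda>x. \<mu> *\<^sub>R h x)"
    by (intro Lp_Minkowski Lp_diff Lp_scaleR p1 f G_Lp[OF h] Y_Lp' a b)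
  also have "\<nu> (\<lambda>x. \<mu> *\<^sub>R h x) = \<mu> * \<nu> h"
    using \<mu> by (simp add: Lp_norm_scaleR[OF p1(2)])
  finally show ?thesis
    unfolding \<mu>_def .
qed

text \<open>The error \<open>f - a 0\<close> equals \<open>y\<close> plus a telescoping sum of the
  pieces \<open>b i\<close>, hence is a convex combination of the functions
  \<open>y + b i / w i\<close>. Smoothness bounds each of their norms by that of the reflected
  function \<open>y - b i / w i\<close>, and the reflected norm is bounded below by an error at a
  later level. The loss \<open>\<epsilon>\<close> arises because the directions \<open>b i\<close>
  are only almost directions of recession.\<close>

lemma error_step_perturbed:
  assumes f: "f \<in> Lp M p" and \<epsilon>: "0 < \<epsilon>"
    and w: "\<And>i. i \<le> Suc I \<Longrightarrow> 0 < w i" "(\<Sum>i\<le>Suc I. w i) = 1"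
    and S: "\<And>x z :: 'a \<Rightarrow> 'k. x \<in> Lp M p \<Longrightarrow> z \<in> Lp M p \<Longrightarrow>
      \<nu> (x + z) powr \<theta> + \<nu> (x - z) powr \<theta> \<le> 2 * \<nu> x powr \<theta> + C * \<nu> z powr \<theta>"
    and \<theta>: "1 \<le> \<theta>" and C: "0 \<le> C"
  shows "E k f powr \<theta> \<le> (\<Sum>i\<le>Suc I. w i * (2 * E (Suc k) f powr \<theta>
      - (if i \<le> I then max 0 (E (Suc k + i) f - \<epsilon>) else 0) powr \<theta>
      + C * (c1 * (1 + 1 / q) * q ^ i * \<eta> (Suc k) f / w i) powr \<theta>))"
proof -
  define h where "h = Q (Suc k) f"
  define y where "y = f - h"
  note hG = Q_G[OF f, of "Suc k", folded h_def]
  have yLp: "y \<in> Lp M p"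
    unfolding y_def by (intro Lp_diff p1 f hG)
  \<comment> \<open>One scale serves all \<open>i\<close>: it dominates \<open>2 / w i\<close>, as
    \<open>perturbation_lower_bound\<close> demands, and makes the extra term there at most
    \<open>\<epsilon>\<close>. The summand 1 gives \<open>r \<ge> 1\<close>.\<close>
  define r where "r = 1 + (\<Sum>i\<le>Suc I. 2 * (1 / w i) * (1 + \<nu> h / \<epsilon>))"
  have summand: "0 \<le> 2 * (1 / w i) * (1 + \<nu> h / \<epsilon>)" if "i \<le> Suc I" for i
    using w(1)[OF that] \<epsilon> by simp
  have r1: "1 \<le> r"
  proof -
    have "0 \<le> (\<Sum>i\<le>Suc I. 2 * (1 / w i) * (1 + \<nu> h / \<epsilon>))"
      by (rule sum_nonneg) (use summand in auto)
    then show ?thesis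
      unfolding r_def by linarith
  qed
  have ri: "2 * (1 / w i) * (1 + \<nu> h / \<epsilon>) \<le> r" if "i \<le> Suc I" for i
    unfolding r_def using member_le_sum[of i "{..Suc I}" "\<lambda>i. 2 * (1 / w i) * (1 + \<nu> h / \<epsilon>)"] summand that
    by fastforce
  have "\<exists>a. (\<lambda>x. r *\<^sub>R a x) \<in> G (2 ^ (k + i)) \<and> a \<in> Y \<and> \<nu> (h - a) \<le> c1 * q ^ (k + i) * normY h" for i
    using Jackson_scaled[OF hG(2), of r "k + i"] r1 by (metis less_le_trans zero_less_one)
  then obtain a where a: "\<And>i. (\<lambda>x. r *\<^sub>R a i x) \<in> G (2 ^ (k + i))" "\<And>i. a i \<in> Y"
      "\<And>i. \<nu> (h - a i) \<le> c1 * q ^ (k + i) * normY h"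
    by metis
  \<comment> \<open>Replacing the last element by \<open>h\<close> makes the telescoping sum end
    exactly at \<open>h\<close>. The final piece \<open>b (Suc I)\<close> is then no scaled
    direction, so only the lower bound 0 is used for it.\<close>
  define A where "A = (\<lambda>i. if i \<le> Suc I then a i else h)"
  define b where "b = (\<lambda>i. A (Suc i) - A i)"
  have AY: "A i \<in> Y" for i
    using a(2) hG by (simp add: A_def)
  have bLp: "b i \<in> Lp M p" for i
    unfolding b_def by (intro Y_Lp' Y_diff AY)
  have Nh: "0 \<le> normY h"
    by (rule normY_nonneg[OF hG(2)])
  have A_err: "\<nu> (h - A i) \<le> c1 * q ^ (k + i) * normY h" for i
    using a(3) c_pos q Nh by (simp add: A_def)
  have b_le: "\<nu> (b i) \<le> c1 * (1 + 1 / q) * q ^ i * \<eta> (Suc k) f" for i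
  proof -
    have "\<nu> (b i) \<le> \<nu> (A (Suc i) - h) + \<nu> (h - A i)"
      unfolding b_def by (intro Lp_norm_diff_triangle p1 Y_Lp' AY hG)
    also have "\<dots> \<le> c1 * q ^ (k + Suc i) * normY h + c1 * q ^ (k + i) * normY h"
      using A_err[of i] A_err[of "Suc i"] by (simp only: Lp_norm_minus_commute[of M p "A (Suc i)"])
    also have "\<dots> = c1 * (1 + 1 / q) * q ^ i * \<eta> (Suc k) f"
      using q by (simp add: h_def power_add field_simps)
    finally show ?thesis .
  qed
  have lower: "(if i \<le> I then max 0 (E (Suc k + i) f - \<epsilon>) else 0) \<le> \<nu> (y - (\<lambda>x. (1 / w i) *\<^sub>R b i x))"
    if i: "i \<le> Suc I" for i
  proof (cases "i \<le> I")
    case True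
    have eq: "b i = a (Suc i) - a i"
      using True by (simp add: b_def A_def)
    have t: "0 < 1 / w i"
      using w(1)[OF i] by simp
    have "2 * (1 / w i) * 1 \<le> 2 * (1 / w i) * (1 + \<nu> h / \<epsilon>)"
      using t \<epsilon> by (intro mult_left_mono) auto
    then have t2: "2 * (1 / w i) \<le> r"
      using ri[OF i] by simp
    have "2 * (1 / w i) * (\<nu> h / \<epsilon>) \<le> 2 * (1 / w i) * (1 + \<nu> h / \<epsilon>)"
      using t by (intro mult_left_mono) auto
    then have "2 * (1 / w i) * (\<nu> h / \<epsilon>) \<le> r"
      using ri[OF i] by linarith
    then have "2 * (1 / w i) * (\<nu> h / \<epsilon>) * \<epsilon> / r \<le> r * \<epsilon> / r"
      using \<epsilon> r1 by (intro divide_right_mono mult_right_mono) auto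
    then have t3: "2 * (1 / w i) / r * \<nu> h \<le> \<epsilon>"
      using \<epsilon> r1 by simp
    \<comment> \<open>The piece \<open>b i\<close> involves levels \<open>k + i\<close> and
      \<open>k + Suc i\<close>; the higher one is the look-ahead level
      \<open>Suc k + i\<close>.\<close>
    have "h \<in> G (2 ^ (Suc k + i))" "(\<lambda>x. r *\<^sub>R a i x) \<in> G (2 ^ (Suc k + i))"
      "(\<lambda>x. r *\<^sub>R a (Suc i) x) \<in> G (2 ^ (Suc k + i))"
      using hG(1) a(1)[of i] a(1)[of "Suc i"] G_pow_mono[of "Suc k" "Suc k + i"] G_pow_mono[of "k + i" "Suc k + i"]
      by auto
    then have "E (Suc k + i) f \<le> \<nu> (f - h - (\<lambda>x. (1 / w i) *\<^sub>R (a (Suc i) - a i) x)) + 2 * (1 / w i) / r * \<nu> h"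
      using t t2 r1 a(2) by (intro perturbation_lower_bound f) auto
    then have "E (Suc k + i) f - \<epsilon> \<le> \<nu> (y - (\<lambda>x. (1 / w i) *\<^sub>R b i x))"
      using t3 unfolding y_def eq by linarith
    then show ?thesis
      using True by simp
  qed simp
  have a0: "a 0 \<in> G (2 ^ k)"
  proof -
    \<comment> \<open>Since \<open>r \<ge> 1\<close>, the element \<open>a 0\<close> lies on the
      segment from 0 to its multiple by \<open>r\<close>, so it is admissible at level
      \<open>k\<close>.\<close>
    have "(\<lambda>x. r *\<^sub>R a 0 x) \<in> G (2 ^ k)" "0 \<in> G (2 ^ k)"
      using a(1)[of 0] zero_in_G[of "2 ^ k"] by simp_all
    from G_convexD[OF this, of "1 / r" "1 - 1 / r"] show ?thesis
      using r1 by simp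
  qed
  have rep: "f - a 0 = (\<Sum>i\<le>Suc I. (\<lambda>x. w i *\<^sub>R (y + (\<lambda>x. (1 / w i) *\<^sub>R b i x)) x))"
  proof -
    have "(\<Sum>i\<le>Suc I. (\<lambda>x. w i *\<^sub>R (y + (\<lambda>x. (1 / w i) *\<^sub>R b i x)) x)) = (\<Sum>i\<le>Suc I. (\<lambda>x. w i *\<^sub>R y x) + b i)"
    proof (rule sum.cong[OF refl])
      fix i assume "i \<in> {..Suc I}"
      then have "0 < w i"
        using w(1) by simp
      then show "(\<lambda>x. w i *\<^sub>R (y + (\<lambda>x. (1 / w i) *\<^sub>R b i x)) x) = (\<lambda>x. w i *\<^sub>R y x) + b i"
        by (auto simp: fun_eq_iff scaleR_right_distrib)
    qed
    also have "\<dots> = (\<Sum>i\<le>Suc I. (\<lambda>x. w i *\<^sub>R y x)) + (\<Sum>i<Suc (Suc I). A (Suc i) - A i)"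
      by (simp only: sum.distrib b_def lessThan_Suc_atMost)
    also have "(\<Sum>i<Suc (Suc I). A (Suc i) - A i) = h - a 0"
      unfolding sum_lessThan_telescope by (simp add: A_def)
    also have "(\<Sum>i\<le>Suc I. (\<lambda>x. w i *\<^sub>R y x)) = y"
    proof
      fix x
      have "(\<Sum>i\<in>S. (\<lambda>x. w i *\<^sub>R y x)) x = (\<Sum>i\<in>S. w i) *\<^sub>R y x" if "finite S" for S
        using that by induction (auto simp: scaleR_left_distrib)
      from this[of "{..Suc I}"] show "(\<Sum>i\<le>Suc I. (\<lambda>x. w i *\<^sub>R y x)) x = y x"
        unfolding w(2) by simp
    qed
    also have "y + (h - a 0) = f - a 0"
      by (simp add: y_def)
    finally show ?thesis
      by (rule sym)
  qed
  have "E k f powr \<theta> \<le> \<nu> (f - a 0) powr \<theta>"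
    using E_le[OF f a0] \<theta> by (intro powr_mono2) auto
  also have "\<dots> \<le> (\<Sum>i\<le>Suc I. w i * \<nu> (y + (\<lambda>x. (1 / w i) *\<^sub>R b i x)) powr \<theta>)"
    unfolding rep
  proof (rule Lp_norm_powr_Jensen[OF p1(1) \<theta> _ _ _ _ w(2)])
    show "y + (\<lambda>x. (1 / w i) *\<^sub>R b i x) \<in> Lp M p" for i
      by (intro Lp_add p1 yLp Lp_scaleR bLp)
  qed (use w(1) in \<open>auto simp: less_imp_le\<close>)
  also have "\<dots> \<le> (\<Sum>i\<le>Suc I. w i * (2 * E (Suc k) f powr \<theta>
      - (if i \<le> I then max 0 (E (Suc k + i) f - \<epsilon>) else 0) powr \<theta>
      + C * (c1 * (1 + 1 / q) * q ^ i * \<eta> (Suc k) f / w i) powr \<theta>))"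
  proof (intro sum_mono mult_left_mono)
    fix i assume "i \<in> {..Suc I}"
    then have i: "i \<le> Suc I" by simp
    show "0 \<le> w i"
      using w(1)[OF i] by simp
    let ?z = "\<lambda>x. (1 / w i) *\<^sub>R b i x"
    have nu_y: "\<nu> y = E (Suc k) f"
      unfolding y_def h_def ..
    have "\<nu> (y + ?z) powr \<theta> \<le> 2 * \<nu> y powr \<theta> - \<nu> (y - ?z) powr \<theta> + C * \<nu> ?z powr \<theta>"
      using S[OF yLp Lp_scaleR[OF bLp, of "1 / w i" i]] by linarith
    also have "\<nu> ?z = 1 / w i * \<nu> (b i)"
      using w(1)[OF i] by (simp add: Lp_norm_scaleR[OF p1(2)])
    also have "2 * \<nu> y powr \<theta> - \<nu> (y - ?z) powr \<theta> + C * (1 / w i * \<nu> (b i)) powr \<theta>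
        \<le> 2 * \<nu> y powr \<theta> - (if i \<le> I then max 0 (E (Suc k + i) f - \<epsilon>) else 0) powr \<theta>
          + C * (1 / w i * (c1 * (1 + 1 / q) * q ^ i * \<eta> (Suc k) f)) powr \<theta>"
    proof (intro add_mono diff_left_mono mult_left_mono powr_mono2 C lower[OF i] b_le)
    qed (use w(1)[OF i] \<theta> in auto)
    finally show "\<nu> (y + ?z) powr \<theta> \<le> 2 * E (Suc k) f powr \<theta>
      - (if i \<le> I then max 0 (E (Suc k + i) f - \<epsilon>) else 0) powr \<theta>
      + C * (c1 * (1 + 1 / q) * q ^ i * \<eta> (Suc k) f / w i) powr \<theta>"
      by (simp only: nu_y times_divide_eq_left mult_1)
  qed
  finally show ?thesis .
qed

text \<open>Limit of the perturbed step as \<open>\<epsilon>\<close> decreases to 0. The scale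
  \<open>r\<close> depends on \<open>\<epsilon>\<close> but does not occur in the inequality, so
  nothing blows up.\<close>

lemma error_step:
  assumes f: "f \<in> Lp M p"
    and w: "\<And>i. i \<le> Suc I \<Longrightarrow> 0 < w i" "(\<Sum>i\<le>Suc I. w i) = 1"
    and S: "\<And>x z :: 'a \<Rightarrow> 'k. x \<in> Lp M p \<Longrightarrow> z \<in> Lp M p \<Longrightarrow>
      \<nu> (x + z) powr \<theta> + \<nu> (x - z) powr \<theta> \<le> 2 * \<nu> x powr \<theta> + C * \<nu> z powr \<theta>"
    and \<theta>: "1 \<le> \<theta>" and C: "0 \<le> C"
  shows "E k f powr \<theta> \<le> (\<Sum>i\<le>Suc I. w i * (2 * E (Suc k) f powr \<theta>
      - (if i \<le> I then E (Suc k + i) f powr \<theta> else 0)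
      + C * (c1 * (1 + 1 / q) * q ^ i * \<eta> (Suc k) f / w i) powr \<theta>))"
proof (rule tendsto_le[of "at_right (0::real)"])
  define a where "a = (\<lambda>i \<epsilon>. (if i \<le> I then max 0 (E (Suc k + i) f - \<epsilon>) else 0) powr \<theta>)"
  let ?r = "\<lambda>i. C * (c1 * (1 + 1 / q) * q ^ i * \<eta> (Suc k) f / w i) powr \<theta>"
  show "\<forall>\<^sub>F \<epsilon> in at_right 0. E k f powr \<theta> \<le> (\<Sum>i\<le>Suc I. w i * (2 * E (Suc k) f powr \<theta> - a i \<epsilon> + ?r i))"
    unfolding eventually_at_filter a_def
    by (intro always_eventually allI impI error_step_perturbed assms) auto
  have a: "(a i \<longlongrightarrow> (if i \<le> I then E (Suc k + i) f powr \<theta> else 0)) (at_right 0)" for i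
  proof (cases "i \<le> I")
    case True
    have "((\<lambda>\<epsilon>. max 0 (E (Suc k + i) f - \<epsilon>) powr \<theta>) \<longlongrightarrow> max 0 (E (Suc k + i) f - 0) powr \<theta>) (at_right 0)"
      using \<theta> by (intro tendsto_powr2 tendsto_intros) (auto intro!: always_eventually)
    then show ?thesis
      using True by (simp add: a_def max_def)
  qed (simp add: a_def)
  show "((\<lambda>\<epsilon>. \<Sum>i\<le>Suc I. w i * (2 * E (Suc k) f powr \<theta> - a i \<epsilon> + ?r i)) \<longlongrightarrow>
      (\<Sum>i\<le>Suc I. w i * (2 * E (Suc k) f powr \<theta>
        - (if i \<le> I then E (Suc k + i) f powr \<theta> else 0) + ?r i))) (at_right 0)"
    by (intro tendsto_intros a)
qed auto

text \<open>Chosen so that the weights \<open>\<rho> * q ^ i\<close> satisfy the smallness condition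
  of \<open>look_ahead_recursion\<close>.\<close>

definition "\<rho> = (1 - q)\<^sup>2 / 2"

lemma \<rho>: "0 < \<rho>" "\<rho> \<le> 1 / 2"
proof -
  have "(1 - q)\<^sup>2 \<le> 1\<^sup>2"
    using q by (intro power_mono) auto
  then show "0 < \<rho>" "\<rho> \<le> 1 / 2"
    using q by (auto simp: \<rho>_def)
qed

lemma sum_\<rho>: "(\<Sum>i\<in>{1..N}. real i * (\<rho> * q ^ i)) \<le> 1 / 2"
proof -
  have "(\<Sum>i\<in>{1..N}. real i * (\<rho> * q ^ i)) = (1 - q)\<^sup>2 * (\<Sum>i\<in>{1..N}. real i * q ^ i) / 2"
    by (simp add: \<rho>_def sum_distrib_left sum_divide_distrib mult_ac)
  then show ?thesis
    using sum_index_power_le[of q N] q by simp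
qed

lemma error_recursion:
  assumes f: "f \<in> Lp M p"
    and S: "\<And>x z :: 'a \<Rightarrow> 'k. x \<in> Lp M p \<Longrightarrow> z \<in> Lp M p \<Longrightarrow>
      \<nu> (x + z) powr \<theta> + \<nu> (x - z) powr \<theta> \<le> 2 * \<nu> x powr \<theta> + C * \<nu> z powr \<theta>"
    and \<theta>: "1 \<le> \<theta>" and C: "0 \<le> C"
  shows "E k f powr \<theta> \<le> E (Suc k) f powr \<theta>
    + (\<Sum>i\<in>{1..Suc I}. \<rho> * q ^ i * (E (Suc k) f powr \<theta> - (if i \<le> I then E (Suc k + i) f powr \<theta> else 0)))
    + C * (c1 * (1 + 1 / q) / \<rho>) powr \<theta> * \<eta> (Suc k) f powr \<theta>"
proof -
  define s where "s = (\<Sum>i\<in>{1..Suc I}. \<rho> * q ^ i)"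
  \<comment> \<open>The weights for \<open>i \<ge> 1\<close> are the small look-ahead weights, and
    index 0 takes the remaining mass. Index 0 costs nothing, because its look-ahead level is
    \<open>Suc k\<close> itself.\<close>
  define w where "w = (\<lambda>i. if i = 0 then 1 - s else \<rho> * q ^ i)"
  define D where "D = E (Suc k) f powr \<theta>"
  define D' where "D' = (\<lambda>i. if i \<le> I then E (Suc k + i) f powr \<theta> else 0)"
  define b where "b = c1 * (1 + 1 / q)"
  have "s \<le> (\<Sum>i\<in>{1..Suc I}. real i * (\<rho> * q ^ i))"
    unfolding s_def using \<rho> q by (intro sum_mono) (auto intro!: mult_le_cancel_right1[THEN iffD2])
  also have "\<dots> \<le> 1 / 2"
    by (rule sum_\<rho>)
  finally have s: "s \<le> 1 / 2" .
  have w_ge: "\<rho> * q ^ i \<le> w i" for i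
    using s \<rho> by (simp add: w_def)
  have w_pos: "0 < w i" for i
  proof -
    have "0 < \<rho> * q ^ i"
      using \<rho> q by simp
    then show ?thesis
      using w_ge[of i] by linarith
  qed
  have split0: "(\<Sum>i\<le>Suc I. g i) = g 0 + (\<Sum>i\<in>{1..Suc I}. g i)" for g :: "nat \<Rightarrow> real"
    by (simp add: sum.atMost_shift sum.shift_bounds_cl_Suc_ivl atMost_atLeast0 sum.atLeast_Suc_atMost)
  have w1: "(\<Sum>i\<le>Suc I. w i) = 1"
  proof -
    have "(\<Sum>i\<in>{1..Suc I}. w i) = s"
      unfolding s_def by (intro sum.cong) (auto simp: w_def)
    then show ?thesis
      unfolding split0 by (simp add: w_def)
  qed
  have \<eta>: "0 \<le> \<eta> (Suc k) f"
    by (rule \<eta>_nonneg[OF f])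
  have b: "0 \<le> b"
    using c_pos q by (simp add: b_def)
  \<comment> \<open>The weights decay at the same rate \<open>q ^ i\<close> as the pieces, so the
    quotient is bounded uniformly in \<open>i\<close> and the weighted sum of remainders does not
    depend on \<open>I\<close>.\<close>
  have ratio: "(b * q ^ i * \<eta> (Suc k) f / w i) powr \<theta> \<le> (b / \<rho>) powr \<theta> * \<eta> (Suc k) f powr \<theta>" for i
  proof -
    have "b * q ^ i * \<eta> (Suc k) f / w i \<le> b * q ^ i * \<eta> (Suc k) f / (\<rho> * q ^ i)"
      using w_ge[of i] \<rho> q b \<eta> by (intro divide_left_mono mult_pos_pos w_pos) auto
    also have "\<dots> = b / \<rho> * \<eta> (Suc k) f"
      using \<rho> q by simp
    finally have "(b * q ^ i * \<eta> (Suc k) f / w i) powr \<theta> \<le> (b / \<rho> * \<eta> (Suc k) f) powr \<theta>"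
      using \<theta> b \<eta> q w_pos[of i] by (intro powr_mono2) (auto intro!: divide_nonneg_pos mult_nonneg_nonneg)
    then show ?thesis
      by (simp only: powr_mult)
  qed
  have "E k f powr \<theta> \<le> (\<Sum>i\<le>Suc I. w i * (2 * D - D' i + C * (b * q ^ i * \<eta> (Suc k) f / w i) powr \<theta>))"
    unfolding D_def D'_def b_def by (rule error_step[OF f w_pos w1 S \<theta> C])
  also have "\<dots> \<le> (\<Sum>i\<le>Suc I. w i * (2 * D - D' i + C * ((b / \<rho>) powr \<theta> * \<eta> (Suc k) f powr \<theta>)))"
    using w_pos C by (intro sum_mono mult_left_mono add_left_mono ratio) (auto simp: less_imp_le)
  also have "\<dots> = (\<Sum>i\<le>Suc I. w i * (D - D' i) + w i * (D + C * ((b / \<rho>) powr \<theta> * \<eta> (Suc k) f powr \<theta>)))"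
    by (intro sum.cong refl) (simp add: algebra_simps)
  also have "\<dots> = (\<Sum>i\<le>Suc I. w i * (D - D' i)) + (D + C * ((b / \<rho>) powr \<theta> * \<eta> (Suc k) f powr \<theta>))"
    by (simp only: sum.distrib w1 mult_1 flip: sum_distrib_right)
  also have "(\<Sum>i\<le>Suc I. w i * (D - D' i)) = (\<Sum>i\<in>{1..Suc I}. \<rho> * q ^ i * (D - D' i))"
  proof -
    have "w 0 * (D - D' 0) = 0"
      by (simp add: D_def D'_def)
    moreover have "(\<Sum>i\<in>{1..Suc I}. w i * (D - D' i)) = (\<Sum>i\<in>{1..Suc I}. \<rho> * q ^ i * (D - D' i))"
      by (intro sum.cong) (auto simp: w_def)
    ultimately show ?thesis
      unfolding split0 by simp
  qed
  finally show ?thesis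
    unfolding D_def D'_def b_def by (simp only: mult.assoc add_ac)
qed

lemma error_le_sum:
  assumes f: "f \<in> Lp M p"
    and S: "\<And>x z :: 'a \<Rightarrow> 'k. x \<in> Lp M p \<Longrightarrow> z \<in> Lp M p \<Longrightarrow>
      \<nu> (x + z) powr \<theta> + \<nu> (x - z) powr \<theta> \<le> 2 * \<nu> x powr \<theta> + C * \<nu> z powr \<theta>"
    and \<theta>: "1 \<le> \<theta>" and C: "0 \<le> C" and "n \<le> L"
  shows "E n f powr \<theta> \<le> 2 * (E L f powr \<theta>
    + C * (c1 * (1 + 1 / q) / \<rho>) powr \<theta> * (\<Sum>m\<in>{n+1..L}. \<eta> m f powr \<theta>))"
  unfolding sum_distrib_left
proof (rule look_ahead_recursion[where w = "\<lambda>i. \<rho> * q ^ i"])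
  show "decseq (\<lambda>k. E k f powr \<theta>)"
    unfolding decseq_def using \<theta> E_decreasing[OF f] by (auto intro!: powr_mono2)
  show "(\<Sum>i\<in>{1..L+1}. real i * (\<rho> * q ^ i)) \<le> 1 / 2"
    by (rule sum_\<rho>)
  show "0 \<le> \<rho> * q ^ i" for i
    using \<rho> q by simp
next
  fix m assume m: "n < m" "m \<le> L"
  then obtain k where k: "m = Suc k"
    by (cases m) auto
  \<comment> \<open>With \<open>I = L - Suc k\<close> every recursion step looks ahead exactly to
    the common horizon \<open>L\<close>.\<close>
  have iff: "i \<le> L - Suc k \<longleftrightarrow> Suc k + i \<le> L" for i
    using m k by auto
  have "E k f powr \<theta> \<le> E (Suc k) f powr \<theta>
      + (\<Sum>i\<in>{1..Suc (L - Suc k)}. \<rho> * q ^ i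
          * (E (Suc k) f powr \<theta> - (if i \<le> L - Suc k then E (Suc k + i) f powr \<theta> else 0)))
      + C * (c1 * (1 + 1 / q) / \<rho>) powr \<theta> * \<eta> (Suc k) f powr \<theta>"
    by (rule error_recursion[OF f S \<theta> C])
  then show "E (m - 1) f powr \<theta> \<le> E m f powr \<theta>
      + (\<Sum>i\<in>{1..L-m+1}. \<rho> * q ^ i * (E m f powr \<theta> - (if m + i \<le> L then E (m + i) f powr \<theta> else 0)))
      + C * (c1 * (1 + 1 / q) / \<rho>) powr \<theta> * \<eta> m f powr \<theta>"
    unfolding k iff by (simp only: diff_Suc_1 Suc_eq_plus1[symmetric])
qed (use \<open>n \<le> L\<close> in auto)

text \<open>The finite-horizon bound on the error is taken to the limit, where the error at the
  horizon vanishes by density. Summability is assumed since a divergent sum, which makes the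
  inequality trivial, has the value 0 under \<open>infsum\<close>.\<close>

lemma lower_estimate:
  obtains C where "0 < C"
    "\<And>f n. f \<in> Lp M p \<Longrightarrow> (\<lambda>k. \<eta> k f powr min 2 p) summable_on {n+1..} \<Longrightarrow>
       K_functional M p Y normY f (q ^ n)
         \<le> C * (\<Sum>\<^sub>\<infinity>k\<in>{n+1..}. \<eta> k f powr min 2 p) powr (1 / min 2 p)"
proof -
  define \<theta> where "\<theta> = min 2 p"
  have \<theta>: "1 \<le> \<theta>" "0 < \<theta>" using p by (auto simp: \<theta>_def)
  obtain C where C: "0 \<le> C"
    "\<And>x z :: 'a \<Rightarrow> 'k. x \<in> Lp M p \<Longrightarrow> z \<in> Lp M p \<Longrightarrow>
      \<nu> (x + z) powr \<theta> + \<nu> (x - z) powr \<theta> \<le> 2 * \<nu> x powr \<theta> + C * \<nu> z powr \<theta>"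
    using Lp_uniform_smoothness[OF p, of M] unfolding \<theta>_def by blast
  define B where "B = 2 * (C * (c1 * (1 + 1 / q) / \<rho>) powr \<theta>)"
  have B: "0 \<le> B"
    using C by (simp add: B_def)
  have "K_functional M p Y normY f (q ^ n)
      \<le> (B powr (1 / \<theta>) + 1 / q) * (\<Sum>\<^sub>\<infinity>k\<in>{n+1..}. \<eta> k f powr \<theta>) powr (1 / \<theta>)"
    if f: "f \<in> Lp M p" and sm: "(\<lambda>k. \<eta> k f powr \<theta>) summable_on {n+1..}" for f n
  proof -
    define T where "T = (\<Sum>\<^sub>\<infinity>k\<in>{n+1..}. \<eta> k f powr \<theta>)"
    have T: "0 \<le> T"
      unfolding T_def by (intro infsum_nonneg) simp
    have T_ge: "(\<Sum>k\<in>F. \<eta> k f powr \<theta>) \<le> T" if "finite F" "F \<subseteq> {n+1..}" for F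
      unfolding T_def using that by (intro finite_sum_le_infsum sm) auto
    have "E (n + 1) f powr \<theta> \<le> 2 * E L f powr \<theta> + B * T" if "n + 1 \<le> L" for L
    proof -
      have "E (n + 1) f powr \<theta> \<le> 2 * E L f powr \<theta> + B * (\<Sum>m\<in>{n+1+1..L}. \<eta> m f powr \<theta>)"
        using error_le_sum[OF f C(2) \<theta>(1) C(1) that] by (simp add: B_def distrib_left)
      also have "\<dots> \<le> 2 * E L f powr \<theta> + B * T"
        using B by (intro add_left_mono mult_left_mono T_ge) auto
      finally show ?thesis .
    qed
    moreover have "(\<lambda>L. 2 * E L f powr \<theta> + B * T) \<longlonglongrightarrow> 2 * 0 powr \<theta> + B * T"
      using \<theta> by (intro tendsto_intros tendsto_powr2 E_tendsto f) auto
    ultimately have "E (n + 1) f powr \<theta> \<le> 2 * 0 powr \<theta> + B * T"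
      by (intro LIMSEQ_le_const) auto
    then have "(E (n + 1) f powr \<theta>) powr (1 / \<theta>) \<le> (B * T) powr (1 / \<theta>)"
      using \<theta> by (intro powr_mono2) auto
    then have E: "E (n + 1) f \<le> B powr (1 / \<theta>) * T powr (1 / \<theta>)"
      using \<theta> by (simp add: powr_powr powr_mult)
    have "(\<eta> (n + 1) f powr \<theta>) powr (1 / \<theta>) \<le> T powr (1 / \<theta>)"
      using T_ge[of "{n + 1}"] \<theta> by (intro powr_mono2) auto
    then have \<eta>: "\<eta> (n + 1) f \<le> T powr (1 / \<theta>)"
      using \<theta> \<eta>_nonneg[OF f, of "n + 1"] by (simp add: powr_powr)
    have "K_functional M p Y normY f (q ^ n) \<le> E (n + 1) f + q ^ n * normY (Q (n + 1) f)"
      using q by (intro K_le Q_G f) auto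
    \<comment> \<open>The shift by one level costs the factor \<open>1 / q\<close>.\<close>
    also have "q ^ n * normY (Q (n + 1) f) = 1 / q * \<eta> (n + 1) f"
      using q by simp
    also have "E (n + 1) f + 1 / q * \<eta> (n + 1) f
        \<le> B powr (1 / \<theta>) * T powr (1 / \<theta>) + 1 / q * T powr (1 / \<theta>)"
      using q by (intro add_mono E mult_left_mono \<eta>) auto
    finally show ?thesis
      by (simp add: T_def distrib_right)
  qed
  moreover have "0 < B powr (1 / \<theta>) + 1 / q"
    using q by (intro add_nonneg_pos) auto
  ultimately show ?thesis
    using that unfolding \<theta>_def by blast
qed

lemma \<eta>_powr: "2 powr (- real k * \<alpha> * s) * normY (Q k f) powr s = \<eta> k f powr s"
  by (simp only: powr_mult powr_powr flip: q_power(3))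

end

theorem theorem2p2:
  fixes M :: "'a measure"
    and p \<alpha> :: real
    and Y :: "('a \<Rightarrow> 'k::{real_normed_field, euclidean_space}) set"
    and normY :: "('a \<Rightarrow> 'k) \<Rightarrow> real"
    and G :: "nat \<Rightarrow> ('a \<Rightarrow> 'k) set"
    and P :: "nat \<Rightarrow> ('a \<Rightarrow> 'k) \<Rightarrow> ('a \<Rightarrow> 'k)"
    and \<tau> \<theta> :: real
  assumes p: "1 < p"
    and \<alpha>: "0 < \<alpha>"
    and Y_sub: "Y \<subseteq> Lp M p" "ae_closed M Y" "linear_subspace Y"
    and normY: "seminorm_on Y normY" "ae_invariant_on M Y normY"
    and G_sub: "\<And>n. n \<ge> 1 \<Longrightarrow> G n \<subseteq> Y" "\<And>n. n \<ge> 1 \<Longrightarrow> ae_closed M (G n)"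
    and G_zero: "0 \<in> G 1"
    and G_mono: "\<And>n. n \<ge> 1 \<Longrightarrow> G n \<subseteq> G (n + 1)"
    and G_sym: "\<And>n. n \<ge> 1 \<Longrightarrow> G n = uminus ` G n"
    and G_dense: "\<And>f \<epsilon>. f \<in> Lp M p \<Longrightarrow> 0 < \<epsilon> \<Longrightarrow> \<exists>n\<ge>1. \<exists>g\<in>G n. Lp_norm M p (f - g) < \<epsilon>"
    and G_convex: "\<And>n. n \<ge> 1 \<Longrightarrow> convex_fun_set (G n)"
    and P_best: "\<And>n f. n \<ge> 1 \<Longrightarrow> f \<in> Lp M p \<Longrightarrow>
          P n f \<in> G n \<and> Lp_norm M p (f - P n f) = approx_error M p (G n) f"
    and Jackson: "\<exists>c\<^sub>1>0. \<forall>f\<in>Y. \<forall>n\<ge>1.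
          approx_error M p (G n) f \<le> c\<^sub>1 * real n powr (- \<alpha>) * normY f"
    and Bernstein: "\<exists>c\<^sub>2>0. \<forall>n\<ge>1. \<forall>g\<^sub>1\<in>G n. \<forall>g\<^sub>2\<in>G n.
          normY (g\<^sub>1 - g\<^sub>2) \<le> c\<^sub>2 * real n powr \<alpha> * Lp_norm M p (g\<^sub>1 - g\<^sub>2)"
    and realization: "\<exists>c\<^sub>3>0. \<forall>f\<in>Lp M p. \<forall>n\<ge>1.
          (INF g\<in>G n. Lp_norm M p (f - g) + real n powr (- \<alpha>) * normY g)
            \<le> c\<^sub>3 * K_functional M p Y normY f (real n powr (- \<alpha>))"
    and \<tau>: "\<tau> = max 2 p"
    and \<theta>: "\<theta> = min 2 p"
  shows "\<exists>C>0. \<exists>C'>0. \<forall>f\<in>Lp M p. \<forall>n\<ge>1.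
      ((\<lambda>k. 2 powr (- real k * \<alpha> * \<tau>) * normY (P (2 ^ k) f) powr \<tau>) summable_on {n+1..} \<and>
       (\<Sum>\<^sub>\<infinity>k\<in>{n+1..}. 2 powr (- real k * \<alpha> * \<tau>) * normY (P (2 ^ k) f) powr \<tau>) powr (1 / \<tau>)
         \<le> C * K_functional M p Y normY f (2 powr (- real n * \<alpha>))) \<and>
      ((\<lambda>k. 2 powr (- real k * \<alpha> * \<theta>) * normY (P (2 ^ k) f) powr \<theta>) summable_on {n+1..} \<longrightarrow>
       K_functional M p Y normY f (2 powr (- real n * \<alpha>))
         \<le> C' * (\<Sum>\<^sub>\<infinity>k\<in>{n+1..}. 2 powr (- real k * \<alpha> * \<theta>) * normY (P (2 ^ k) f) powr \<theta>) powr (1 / \<theta>))"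
proof -
  obtain c1 c2 c3 where c: "0 < c1" "0 < c2" "0 < c3"
    and J: "\<forall>f\<in>Y. \<forall>n\<ge>1. approx_error M p (G n) f \<le> c1 * real n powr (- \<alpha>) * normY f"
    and B: "\<forall>n\<ge>1. \<forall>g\<^sub>1\<in>G n. \<forall>g\<^sub>2\<in>G n.
          normY (g\<^sub>1 - g\<^sub>2) \<le> c2 * real n powr \<alpha> * Lp_norm M p (g\<^sub>1 - g\<^sub>2)"
    and R: "\<forall>f\<in>Lp M p. \<forall>n\<ge>1.
          (INF g\<in>G n. Lp_norm M p (f - g) + real n powr (- \<alpha>) * normY g)
            \<le> c3 * K_functional M p Y normY f (real n powr (- \<alpha>))"
    using Jackson Bernstein realization by blast
  interpret convex_approximation M p \<alpha> c1 c2 c3 Y normY G P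
    by unfold_locales
      (rule p \<alpha> Y_sub normY G_sub G_zero G_mono G_sym G_dense G_convex P_best c
        J[rule_format] B[rule_format] R[rule_format]; assumption)+
  obtain C where C: "0 < C"
    "\<And>f n. f \<in> Lp M p \<Longrightarrow> (\<lambda>k. \<eta> k f powr max 2 p) summable_on {n+1..}"
    "\<And>f n. f \<in> Lp M p \<Longrightarrow> (\<Sum>\<^sub>\<infinity>k\<in>{n+1..}. \<eta> k f powr max 2 p) powr (1 / max 2 p)
       \<le> C * K_functional M p Y normY f (q ^ n)"
    using upper_estimate by blast
  obtain C' where C': "0 < C'"
    "\<And>f n. f \<in> Lp M p \<Longrightarrow> (\<lambda>k. \<eta> k f powr min 2 p) summable_on {n+1..} \<Longrightarrow>
       K_functional M p Y normY f (q ^ n)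
         \<le> C' * (\<Sum>\<^sub>\<infinity>k\<in>{n+1..}. \<eta> k f powr min 2 p) powr (1 / min 2 p)"
    using lower_estimate by blast
  \<comment> \<open>The rewriting moves the weights inside the powers, which gives the sums of
    \<open>\<eta>\<close> estimated above.\<close>
  show ?thesis
    unfolding \<eta>_powr unfolding q_power(3) \<tau> \<theta>
    using C C' by blast
qed

end
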